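(* Let $p$ be a prime, let $n \geq 2$, and let $u(x)=1$ be a regular equation in one unknown $x$ over the group $\mathrm{UT}_n(\mathbb{F}_p)$ with exponent $\epsilon = rp^s$, where $r \in \mathbb{Z}$, $s \in \mathbb{N}$ (with $s=0$ allowed) and $\gcd(r,p)=1$. Write $u(1) = (a_{i,j}) \in \mathrm{UT}_n(\mathbb{F}_p)$. Suppose that at least one of the following conditions holds: 1) $a_{i,i+1} \neq 0$ for all $i=2,\dots,n-1$; 2) $a_{i,i+1} \neq 0$ for all $i=1,\dots,n-2$; 3) $u(1)$ is a central element of $\mathrm{UT}_n(\mathbb{F}_p)$. Then the equation $u(x)=1$ is solvable in an overgroup of $\mathrm{UT}_n(\mathbb{F}_p)$ isomorphic to $\mathrm{UT}_m(\mathbb{F}_p)$, where $m=(n-1)p^s+1$.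
   Context: $\mathbb{F}_p$ is the field with $p$ elements, and $\mathrm{UT}_n(\mathbb{F}_p)$ is the group of $n\times n$ upper unitriangular matrices over $\mathbb{F}_p$. An equation with the variable $x$ over a group $G$ is an expression $u(x)=1$, where $u(x) = x^{\epsilon_1} g_1 x^{\epsilon_2} g_2 \cdots x^{\epsilon_k} g_k$ is an element of the free product $G * \langle x\rangle$ of $G$ with the infinite cyclic group $\langle x \rangle$ ($g_i \in G$, $\epsilon_i \in \mathbb{Z}$). Its exponent is $\epsilon = \sum_{i=1}^k \epsilon_i$, and the equation is called regular if $\epsilon \neq 0$. The element $u(1) = g_1 g_2\cdots g_k \in G$ is obtained by substituting $x=1$. An overgroup of $G$ is a group $H$ containing $G$ as a fixed subgroup (equivalently, a group $H$ with a fixed injective homomorphism $\phi: G \to H$). The equation is solvable in the overgroup $H$ if there is $h \in H$ with $u(h)=1$, i.e. $h^{\epsilon_1}\phi(g_1) h^{\epsilon_2}\phi(g_2)\cdots h^{\epsilon_k}\phi(g_k)=1$ in $H$. *)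

theory Defs
  imports
    "Jordan_Normal_Form.Matrix"
    "HOL-Library.Cardinality"
    "HOL-Computational_Algebra.Primes"
begin

definition UT :: "nat \<Rightarrow> 'a::field mat monoid" where
  "UT n =
     \<lparr>carrier = {A \<in> carrier_mat n n. upper_triangular A \<and> (\<forall>i<n. A $$ (i, i) = 1)},
      mult = (*), one = 1\<^sub>m n\<rparr>"

(* The list [(e1, g1), ..., (ek, gk)] stands for the element x^e1 g1 ... x^ek gk of the free
   product of G and the infinite cyclic group generated by x.  Every element of the free product
   has such an expression; the notions below depend only on the element, not on the expression. *)
type_synonym 'g eqn = "(int \<times> 'g) list"

definition eqn_over :: "('g, 'm) monoid_scheme \<Rightarrow> 'g eqn \<Rightarrow> bool" where
  "eqn_over G u \<longleftrightarrow> (\<forall>(e, g) \<in> set u. g \<in> carrier G)"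

definition eqn_exponent :: "'g eqn \<Rightarrow> int" where
  "eqn_exponent u = (\<Sum>(e, g) \<leftarrow> u. e)"

definition regular_eqn :: "'g eqn \<Rightarrow> bool" where
  "regular_eqn u \<longleftrightarrow> eqn_exponent u \<noteq> 0"

(* The value of u at x = h in H, its coefficients being mapped to H by f. *)
definition eqn_value :: "('h, 'm) monoid_scheme \<Rightarrow> ('g \<Rightarrow> 'h) \<Rightarrow> 'g eqn \<Rightarrow> 'h \<Rightarrow> 'h" where
  "eqn_value H f u h =
     foldr (\<lambda>(e, g) y. (h [^]\<^bsub>H\<^esub> e) \<otimes>\<^bsub>H\<^esub> f g \<otimes>\<^bsub>H\<^esub> y) u \<one>\<^bsub>H\<^esub>"

definition overgroup ::
  "('g, 'm) monoid_scheme \<Rightarrow> ('h, 'k) monoid_scheme \<Rightarrow> ('g \<Rightarrow> 'h) \<Rightarrow> bool" where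
  "overgroup G H f \<longleftrightarrow> group H \<and> f \<in> mon G H"

definition solvable_in :: "('h, 'm) monoid_scheme \<Rightarrow> ('g \<Rightarrow> 'h) \<Rightarrow> 'g eqn \<Rightarrow> bool" where
  "solvable_in H f u \<longleftrightarrow> (\<exists>h \<in> carrier H. eqn_value H f u h = \<one>\<^bsub>H\<^esub>)"

definition central :: "('g, 'm) monoid_scheme \<Rightarrow> 'g \<Rightarrow> bool" where
  "central G z \<longleftrightarrow> z \<in> carrier G \<and> (\<forall>g \<in> carrier G. z \<otimes>\<^bsub>G\<^esub> g = g \<otimes>\<^bsub>G\<^esub> z)"

(* The entry in row i and column j, counted from 1; indices of type mat start at 0. *)
definition entry :: "'a mat \<Rightarrow> nat \<Rightarrow> nat \<Rightarrow> 'a" where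
  "entry A i j = A $$ (i - 1, j - 1)"

end

(* The overgroup is UT m itself.  With q = p^s, the residue classes modulo q split the m indices into
   one class of size n and q - 1 classes of size n - 1, and UT n is embedded in UT m by acting on the
   large class and, through its upper left or lower right corner block, on each of the others.  The
   images of the coefficients differ from 1 only from the q-th superdiagonal on, so u(h) - h^(rq)
   hardly depends on h, while h^q = 1 + (h - 1)^q in characteristic p.  The first superdiagonal of h
   is chosen so that the q-th superdiagonal of u(h) vanishes; by the hypothesis on u(1) it has at most
   one zero entry, at one of its ends.  A change of h on the superdiagonal d - q + 1 then changes the
   superdiagonal d of u(h) by a banded triangular linear map, which is surjective, so the further
   superdiagonals of u(h) can be removed one after the other.  If u(1) is central, UT n instead acts
   on the first n - 1 indices and the last one, and h = 1 + X, where X is a path from the first to the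
   last index through indices in between, commutes with all coefficients. *)
theory Submission
  imports Defs
    "HOL-Computational_Algebra.Formal_Power_Series"
    "HOL-Number_Theory.Residues"
    "HOL-Algebra.Coset"
begin

section \<open>The ring of infinite upper triangular matrices\<close>

text \<open>Upper triangular matrices over the index set of all natural numbers; \<open>diag A d k\<close> is the
  entry in row \<open>k\<close> and column \<open>k + d\<close>.\<close>

datatype 'a utm = UTM (diag: "nat \<Rightarrow> nat \<Rightarrow> 'a")

lemma utm_eqI: "(\<And>d k. diag A d k = diag B d k) \<Longrightarrow> A = B"
  by (simp add: utm.expand fun_eq_iff)

instantiation utm :: (ring_1) ring_1
begin

definition "0 = UTM (\<lambda>d k. 0)"
definition "1 = UTM (\<lambda>d k. if d = 0 then 1 else 0)"
definition "A + B = UTM (\<lambda>d k. diag A d k + diag B d k)"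
definition "A - B = UTM (\<lambda>d k. diag A d k - diag B d k)"
definition "- A = UTM (\<lambda>d k. - diag A d k)"
text \<open>The intermediate index of a matrix product runs only from k to k + d, so the sum is
  finite although the matrices are infinite.\<close>

definition "A * B = UTM (\<lambda>d k. \<Sum>e=0..d. diag A e k * diag B (d - e) (k + e))"

instance
proof
  fix A B C :: "'a utm"
  show "A * B * C = A * (B * C)"
  proof (rule utm_eqI)
    fix d k
    have "diag (A * B * C) d k =
        (\<Sum>j=0..d. \<Sum>i=0..j. diag A i k * diag B (j - i) (k + i) * diag C (d - j) (k + (i + (j - i))))"
      by (simp add: times_utm_def sum_distrib_right)
    also have "\<dots> = (\<Sum>j=0..d. \<Sum>i=0..d - j.
        diag A j k * diag B i (k + j) * diag C (d - j - i) (k + (j + i)))"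
      \<comment> \<open>The regrouping is that of Cauchy products; the row shifts ride along in the
        summand.\<close>
      by (rule fps_mult_assoc_lemma
          [of "\<lambda>i l r. diag A i k * diag B l (k + i) * diag C r (k + (i + l))" d d])
    finally show "diag (A * B * C) d k = diag (A * (B * C)) d k"
      by (simp add: times_utm_def sum_distrib_left mult.assoc add.assoc)
  qed
  show "1 * A = A"
    by (rule utm_eqI) (simp add: times_utm_def one_utm_def if_distrib [of "\<lambda>x. x * _"] cong: if_cong)
  show "A * 1 = A"
    by (rule utm_eqI) (simp add: times_utm_def one_utm_def if_distrib [of "\<lambda>x. _ * x"] cong: if_cong)
  have "diag (0 :: 'a utm) 0 0 \<noteq> diag 1 0 0" by (simp add: zero_utm_def one_utm_def)
  then show "(0 :: 'a utm) \<noteq> 1" by metis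
qed (rule utm_eqI; simp add: zero_utm_def plus_utm_def minus_utm_def uminus_utm_def times_utm_def
    algebra_simps sum.distrib)+

end

lemma diag_simps [simp]:
  fixes A B :: "'a::ring_1 utm"
  shows "diag (0 :: 'a utm) d k = 0"
    and "diag (1 :: 'a utm) d k = (if d = 0 then 1 else 0)"
    and "diag (A + B) d k = diag A d k + diag B d k"
    and "diag (A - B) d k = diag A d k - diag B d k"
    and "diag (- A) d k = - diag A d k"
  by (simp_all add: zero_utm_def one_utm_def plus_utm_def minus_utm_def uminus_utm_def)

lemma diag_mult: "diag (A * B) d k = (\<Sum>e=0..d. diag A e k * diag B (d - e) (k + e))"
  by (simp add: times_utm_def)

lemma diag_sum: "diag (\<Sum>i\<in>I. f i) d k = (\<Sum>i\<in>I. diag (f i) d k)"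
  for f :: "'b \<Rightarrow> 'a::ring_1 utm"
  by (induction I rule: infinite_finite_induct) simp_all

lemma diag_of_nat: "diag (of_nat r :: 'a::ring_1 utm) d k = (if d = 0 then of_nat r else 0)"
  by (induction r) simp_all

lemma diag_of_nat_mult: "diag (of_nat r * A) d k = of_nat r * diag A d k"
  for A :: "'a::ring_1 utm"
  by (induction r) (simp_all add: algebra_simps)

section \<open>Filtration by superdiagonals and leading entries\<close>

text \<open>The size \<open>m\<close> of finite matrices enters through these ideals only: modulo \<open>lev m m\<close>, everything
  outside the upper left block of size \<open>m\<close> is ignored.\<close>

definition lev :: "nat \<Rightarrow> nat \<Rightarrow> 'a::ring_1 utm set" where
  "lev m d = {A. \<forall>e k. e < d \<longrightarrow> k + e < m \<longrightarrow> diag A e k = 0}"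

lemma lev_0 [simp]: "A \<in> lev m 0"
  and lev_zero [simp]: "0 \<in> lev m d"
  by (simp_all add: lev_def)

lemma levD: "A \<in> lev m d \<Longrightarrow> e < d \<Longrightarrow> k + e < m \<Longrightarrow> diag A e k = 0"
  by (simp add: lev_def)

lemma lev_mono: "A \<in> lev m d' \<Longrightarrow> d \<le> d' \<Longrightarrow> A \<in> lev m d"
  by (auto simp: lev_def)

lemma lev_add: "A \<in> lev m d \<Longrightarrow> B \<in> lev m d \<Longrightarrow> A + B \<in> lev m d"
  and lev_diff: "A \<in> lev m d \<Longrightarrow> B \<in> lev m d \<Longrightarrow> A - B \<in> lev m d"
  by (simp_all add: lev_def)

text \<open>Each term at offset c < d + e splits c into i and c - i, so that i < d or c - i < e, and
  the intermediate index k + i stays below m.\<close>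

lemma lev_mult: "A \<in> lev m d \<Longrightarrow> B \<in> lev m e \<Longrightarrow> A * B \<in> lev m (d + e)"
  unfolding lev_def mem_Collect_eq diag_mult
proof (intro allI impI)
  fix c k assume *: "\<forall>e k. e < d \<longrightarrow> k + e < m \<longrightarrow> diag A e k = 0"
    "\<forall>d k. d < e \<longrightarrow> k + d < m \<longrightarrow> diag B d k = 0" "c < d + e" "k + c < m"
  show "(\<Sum>i=0..c. diag A i k * diag B (c - i) (k + i)) = 0"
  proof (rule sum.neutral, rule ballI)
    fix i assume "i \<in> {0..c}"
    then consider "i < d" "k + i < m" | "c - i < e" "k + i + (c - i) < m" using *(3,4) by force
    then show "diag A i k * diag B (c - i) (k + i) = 0" by cases (use *(1,2) in simp_all)
  qed
qed

lemma lev_mult_left: "B \<in> lev m d \<Longrightarrow> A * B \<in> lev m d"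
  and lev_mult_right: "A \<in> lev m d \<Longrightarrow> A * B \<in> lev m d"
  using lev_mult [of A m 0 B d] lev_mult [of A m d B 0] by simp_all

lemma lev_of_nat_mult: "A \<in> lev m d \<Longrightarrow> of_nat r * A \<in> lev m d"
  by (rule lev_mult_left)

lemma lev_sum: "(\<And>i. i \<in> I \<Longrightarrow> f i \<in> lev m d) \<Longrightarrow> (\<Sum>i\<in>I. f i) \<in> lev m d"
  by (induction I rule: infinite_finite_induct) (simp_all add: lev_add)

lemma lev_power: "A \<in> lev m 1 \<Longrightarrow> A ^ i \<in> lev m i"
proof (induction i)
  case (Suc i)
  then show ?case using lev_mult [of A m 1 "A ^ i" i] by simp
qed simp

text \<open>For i < d the factor from \<open>A\<close> vanishes, for i > d the one from
  \<open>B\<close>; only i = d is left.\<close>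

lemma diag_mult_lead:
  assumes "A \<in> lev m d" "B \<in> lev m e" "k + d + e < m"
  shows "diag (A * B) (d + e) k = diag A d k * diag B e (k + d)"
proof -
  have "(\<Sum>i=0..d + e. diag A i k * diag B (d + e - i) (k + i)) =
      (\<Sum>i=0..d + e. if i = d then diag A d k * diag B e (k + d) else 0)"
  proof (rule sum.cong)
    fix i assume i: "i \<in> {0..d + e}"
    consider "i < d" | "i = d" | "i > d" by linarith
    then show "diag A i k * diag B (d + e - i) (k + i) =
        (if i = d then diag A d k * diag B e (k + d) else 0)"
    proof cases
      case 1 then show ?thesis using levD [OF assms(1) 1] assms(3) by simp
    next
      case 3
      then have "diag B (d + e - i) (k + i) = 0"
        using i assms(3) by (intro levD [OF assms(2)]) auto
      with 3 show ?thesis by simp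
    qed simp
  qed simp
  then show ?thesis by (simp add: diag_mult)
qed

lemma diag_power_lead:
  assumes "X \<in> lev m 1" "k + i < m"
  shows "diag (X ^ i) i k = (\<Prod>j<i. diag X 1 (k + j))"
  using assms(2)
proof (induction i arbitrary: k)
  case (Suc i)
  have "diag (X * X ^ i) (1 + i) k = diag X 1 k * diag (X ^ i) i (k + 1)"
    using Suc.prems assms(1) lev_power [OF assms(1), of i] by (intro diag_mult_lead) simp_all
  then show ?case using Suc by (simp add: prod.lessThan_Suc_shift del: prod.lessThan_Suc)
qed simp

section \<open>Binomial expansion and Frobenius map\<close>

text \<open>The ring may be noncommutative; the expansion is valid because 1 and x commute.\<close>

lemma one_plus_power_binomial: "(1 + x) ^ n = (\<Sum>k\<le>n. of_nat (n choose k) * x ^ k)"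
  for x :: "'a::ring_1"
proof (induction n)
  case (Suc n)
  have "(\<Sum>k\<le>Suc n. of_nat (Suc n choose k) * x ^ k) =
      1 + (\<Sum>k\<le>n. of_nat (n choose Suc k) * x ^ Suc k) + (\<Sum>k\<le>n. of_nat (n choose k) * x ^ Suc k)"
    by (simp add: sum.atMost_Suc_shift sum.distrib algebra_simps del: sum.atMost_Suc power_Suc)
  also have "1 + (\<Sum>k\<le>n. of_nat (n choose Suc k) * x ^ Suc k) = (\<Sum>k\<le>Suc n. of_nat (n choose k) * x ^ k)"
    by (simp only: sum.atMost_Suc_shift) simp
  also have "\<dots> = (\<Sum>k\<le>n. of_nat (n choose k) * x ^ k)" by (simp add: binomial_eq_0)
  finally have *: "(\<Sum>k\<le>Suc n. of_nat (Suc n choose k) * x ^ k) =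
      (\<Sum>k\<le>n. of_nat (n choose k) * x ^ k) + (\<Sum>k\<le>n. of_nat (n choose k) * x ^ Suc k)" .
  have "x * (of_nat (n choose k) * x ^ k) = of_nat (n choose k) * x ^ Suc k" for k
    by (metis mult.assoc mult_of_nat_commute power_Suc)
  then show ?case unfolding * by (simp add: Suc distrib_right sum_distrib_left sum.distrib del: sum.atMost_Suc)
qed simp

text \<open>The inner binomial coefficients are multiples of p and vanish in the ring.\<close>

lemma one_plus_power_prime:
  fixes x :: "'a::ring_1"
  assumes "prime p" "of_nat p = (0 :: 'a)"
  shows "(1 + x) ^ p = 1 + x ^ p"
proof -
  have "p > 0" using assms(1) prime_gt_0_nat by blast
  have "(1 + x) ^ p = (\<Sum>k\<in>{0, p}. of_nat (p choose k) * x ^ k)"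
    unfolding one_plus_power_binomial
  proof (rule sum.mono_neutral_right)
    show "\<forall>k\<in>{..p} - {0, p}. of_nat (p choose k) * x ^ k = 0"
    proof
      fix k assume "k \<in> {..p} - {0, p}"
      then have "p dvd p choose k" using assms(1) by (intro dvd_choose_prime) auto
      then show "of_nat (p choose k) * x ^ k = 0" using assms(2) by (auto simp: dvd_def)
    qed
  qed auto
  then show ?thesis using \<open>p > 0\<close> by simp
qed

lemma one_plus_power_prime_power:
  fixes x :: "'a::ring_1"
  assumes "prime p" "of_nat p = (0 :: 'a)"
  shows "(1 + x) ^ p ^ s = 1 + x ^ p ^ s"
  by (induction s) (simp_all add: power_mult one_plus_power_prime [OF assms] mult.commute [of p])

lemma of_nat_utm_eq_0: "of_nat p = (0 :: 'a::ring_1) \<Longrightarrow> of_nat p = (0 :: 'a utm)"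
  by (rule utm_eqI) (simp add: diag_of_nat)

subsection \<open>Congruences between values of an equation\<close>

lemma lev_power_cong:
  "A - B \<in> lev m d \<Longrightarrow> A ^ e - B ^ e \<in> lev m d"
proof (induction e)
  case (Suc e)
  have "A ^ Suc e - B ^ Suc e = A * (A ^ e - B ^ e) + (A - B) * B ^ e" by (simp add: algebra_simps)
  with Suc show ?case by (simp add: lev_add lev_mult_left lev_mult_right)
qed simp

text \<open>First-order expansion: \<open>A\<close> and \<open>B\<close> are 1 up to
  \<open>lev m 1\<close>, so replacing a factor next to A - B by 1 costs only a term one level
  deeper.\<close>

lemma lev_power_diff:
  assumes "A - B \<in> lev m d" "A - 1 \<in> lev m 1" "B - 1 \<in> lev m 1"
  shows "A ^ r - B ^ r - of_nat r * (A - B) \<in> lev m (Suc d)"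
proof (induction r)
  case (Suc r)
  have B: "B ^ r - 1 \<in> lev m 1" using lev_power_cong [OF assms(3), of r] by simp
  have "A ^ Suc r - B ^ Suc r - of_nat (Suc r) * (A - B) =
      (A ^ r - B ^ r - of_nat r * (A - B)) * A + of_nat r * ((A - B) * (A - 1)) + (B ^ r - 1) * (A - B)"
    by (simp add: algebra_simps power_commutes)
  moreover have "(A - B) * (A - 1) \<in> lev m (Suc d)" "(B ^ r - 1) * (A - B) \<in> lev m (Suc d)"
    using lev_mult [OF assms(1,2)] lev_mult [OF B assms(1)] by simp_all
  ultimately show ?case using Suc by (simp add: lev_add lev_mult_left lev_mult_right)
qed simp

text \<open>Exponents are natural numbers because a ring offers no inverses; integer exponents are
  reduced modulo a power of p beforehand.\<close>

fun utm_value :: "(nat \<times> 'a::ring_1 utm) list \<Rightarrow> 'a utm \<Rightarrow> 'a utm" where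
  "utm_value [] T = 1"
| "utm_value ((e, G) # us) T = T ^ e * G * utm_value us T"

text \<open>\<open>utm_value us T - T ^ ex\<close> is a sum of terms each of which contains a factor \<open>G - 1\<close>.\<close>

lemma utm_value_diff:
  assumes "T' - T \<in> lev m D" "\<forall>(e, G)\<in>set us. G - 1 \<in> lev m q"
  defines "ex \<equiv> sum_list (map fst us)"
  shows "(utm_value us T' - T' ^ ex) - (utm_value us T - T ^ ex) \<in> lev m (D + q)"
proof -
  have cong: "utm_value us T' - utm_value us T \<in> lev m D" for us
  proof (induction us)
    case (Cons u us)
    obtain e G where u: "u = (e, G)" by (cases u)
    have "utm_value (u # us) T' - utm_value (u # us) T =
        (T' ^ e - T ^ e) * G * utm_value us T' + T ^ e * G * (utm_value us T' - utm_value us T)"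
      by (simp add: u algebra_simps)
    with Cons lev_power_cong [OF assms(1), of e] show ?case
      by (simp add: lev_add lev_mult_left lev_mult_right)
  qed simp
  \<comment> \<open>Both congruences go through the induction together: the second one gives the
    extra q levels when \<open>T ^ e\<close> changes in front of the tail.\<close>
  have "(utm_value us T' - T' ^ sum_list (map fst us)) - (utm_value us T - T ^ sum_list (map fst us))
      \<in> lev m (D + q) \<and> (utm_value us T - T ^ sum_list (map fst us)) \<in> lev m q"
    using assms(2)
  proof (induction us)
    case (Cons u us)
    obtain e G where u: "u = (e, G)" by (cases u)
    define w where "w S = utm_value us S - S ^ sum_list (map fst us)" for S
    have G: "G - 1 \<in> lev m q" using Cons.prems u by simp
    have IH: "w T' - w T \<in> lev m (D + q)" "w T \<in> lev m q" using Cons by (simp_all add: w_def)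
    have Te: "T' ^ e - T ^ e \<in> lev m D" using assms(1) by (rule lev_power_cong)
    \<comment> \<open>Writing G = 1 + (G - 1) separates the contribution of the tail from one new
      term with the factor G - 1.\<close>
    have W: "utm_value (u # us) S - S ^ sum_list (map fst (u # us)) =
        S ^ e * w S + S ^ e * ((G - 1) * utm_value us S)" for S
      by (simp add: u w_def algebra_simps power_add)
    have "S' * x' + S' * (g * y') - (S * x + S * (g * y)) =
        S' * (x' - x) + (S' - S) * x + ((S' - S) * g * y' + S * (g * (y' - y)))"
      for S S' x x' g y y' :: "'a utm" by (simp add: algebra_simps)
    then have "(utm_value (u # us) T' - T' ^ sum_list (map fst (u # us))) -
        (utm_value (u # us) T - T ^ sum_list (map fst (u # us))) =
        T' ^ e * (w T' - w T) + (T' ^ e - T ^ e) * w T +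
        ((T' ^ e - T ^ e) * (G - 1) * utm_value us T' +
         T ^ e * ((G - 1) * (utm_value us T' - utm_value us T)))"
      unfolding W .
    moreover have "(G - 1) * (utm_value us T' - utm_value us T) \<in> lev m (D + q)"
      using lev_mult [OF G cong] by (simp add: add.commute)
    ultimately show ?case
      unfolding W using IH G lev_mult [OF Te IH(2)] lev_mult [OF Te G]
      by (simp add: lev_add lev_mult_left lev_mult_right)
  qed simp
  then show ?thesis by (simp add: ex_def)
qed

text \<open>The sum is the part linear in \<open>Y\<close>. A product with two or more factors
  \<open>Y\<close> lies at level 2 D + l - 1 or deeper, and D \<ge> 2 puts this beyond the level D +
  l of the linear part.\<close>

lemma power_perturb:
  assumes X: "X \<in> lev m 1" and Y: "Y \<in> lev m D" and D: "D \<ge> 2"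
  shows "(X + Y) ^ Suc l - X ^ Suc l - (\<Sum>i\<le>l. X ^ i * Y * X ^ (l - i)) \<in> lev m (Suc (D + l))"
proof (induction l)
  case (Suc l)
  define S where "S = (\<Sum>i\<le>l. X ^ i * Y * X ^ (l - i))"
  define E where "E = (X + Y) ^ Suc l - X ^ Suc l - S"
  have S: "S \<in> lev m (D + l)"
    unfolding S_def
  proof (rule lev_sum)
    fix i assume "i \<in> {..l}"
    then show "X ^ i * Y * X ^ (l - i) \<in> lev m (D + l)"
      using lev_mult [OF lev_mult [OF lev_power [OF X, of i] Y] lev_power [OF X, of "l - i"]]
      by (simp add: ac_simps)
  qed
  have XY: "X + Y \<in> lev m 1" using X Y D by (simp add: lev_add lev_mono [OF Y])
  have 1: "(\<Sum>i\<le>Suc l. X ^ i * Y * X ^ (Suc l - i)) = Y * X ^ Suc l + X * S"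
    by (simp add: S_def sum.atMost_Suc_shift sum_distrib_left mult.assoc del: sum.atMost_Suc)
  have 2: "(X + Y) ^ Suc (Suc l) = (X + Y) * (X ^ Suc l + S + E)"
    by (simp add: E_def)
  have "(X + Y) ^ Suc (Suc l) - X ^ Suc (Suc l) - (\<Sum>i\<le>Suc l. X ^ i * Y * X ^ (Suc l - i)) =
      Y * S + (X + Y) * E"
    unfolding 1 2 by (simp add: algebra_simps)
  moreover have "Y * S \<in> lev m (Suc (D + Suc l))"
    using D by (intro lev_mono [OF lev_mult [OF Y S]]) simp
  moreover have "(X + Y) * E \<in> lev m (Suc (D + Suc l))"
    using lev_mult [OF XY Suc.IH] unfolding E_def S_def by simp
  ultimately show ?case by (simp add: lev_add)
qed simp

section \<open>Recursive solution of systems with a bounded window\<close>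

text \<open>The values y k are chosen for k = K - 1 down to 0; condition k does not look below k, so
  later choices leave it intact. \<open>Q\<close> is an invariant, such as nonvanishing, that keeps
  the next step solvable.\<close>

lemma solve_backward:
  fixes P :: "nat \<Rightarrow> (nat \<Rightarrow> 'a) \<Rightarrow> bool"
  assumes loc: "\<And>k y y'. (\<And>j. k \<le> j \<Longrightarrow> y j = y' j) \<Longrightarrow> P k y \<Longrightarrow> P k y'"
    and step: "\<And>k y. k < K \<Longrightarrow> (\<And>j. Q j (y j)) \<Longrightarrow> \<exists>v. Q k v \<and> P k (y(k := v))"
    and Q: "\<And>j. \<exists>v. Q j v"
  shows "\<exists>y. (\<forall>j. Q j (y j)) \<and> (\<forall>k<K. P k y)"
proof -
  have "\<exists>y. (\<forall>j. Q j (y j)) \<and> (\<forall>k<K. K \<le> k + i \<longrightarrow> P k y)" if "i \<le> K" for i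
    using that
  proof (induction i)
    case 0
    from Q obtain y where "\<forall>j. Q j (y j)" by metis
    then show ?case by (intro exI [of _ y]) auto
  next
    case (Suc i)
    then obtain y where y: "\<forall>j. Q j (y j)" "\<forall>k<K. K \<le> k + i \<longrightarrow> P k y" by auto
    define k0 where "k0 = K - Suc i"
    from step [of k0 y] y(1) Suc.prems obtain v where v: "Q k0 v" "P k0 (y(k0 := v))"
      by (auto simp: k0_def)
    have "P k (y(k0 := v))" if "k < K" "K \<le> k + Suc i" for k
    proof (cases "k = k0")
      case False
      then have "k > k0" using that by (simp add: k0_def)
      then have "P k y" using that y(2) Suc.prems by (simp add: k0_def)
      then show ?thesis by (rule loc [of k y, rotated]) (use \<open>k > k0\<close> in simp)
    qed (use v in simp)
    moreover have "Q j ((y(k0 := v)) j)" for j using y(1) v(1) by simp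
    ultimately show ?case by blast
  qed
  from this [of K] show ?thesis by simp
qed

text \<open>The mirror image: condition k looks no further than k + l, and it is met by the choice
  of y (k + l).\<close>

lemma solve_forward:
  fixes P :: "nat \<Rightarrow> (nat \<Rightarrow> 'a) \<Rightarrow> bool"
  assumes loc: "\<And>k y y'. (\<And>j. j \<le> k + l \<Longrightarrow> y j = y' j) \<Longrightarrow> P k y \<Longrightarrow> P k y'"
    and step: "\<And>k y. k < K \<Longrightarrow> (\<And>j. Q j (y j)) \<Longrightarrow> \<exists>v. Q (k + l) v \<and> P k (y(k + l := v))"
    and Q: "\<And>j. \<exists>v. Q j v"
  shows "\<exists>y. (\<forall>j. Q j (y j)) \<and> (\<forall>k<K. P k y)"
proof -
  have "\<exists>y. (\<forall>j. Q j (y j)) \<and> (\<forall>k<i. P k y)" if "i \<le> K" for i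
    using that
  proof (induction i)
    case 0
    from Q obtain y where "\<forall>j. Q j (y j)" by metis
    then show ?case by auto
  next
    case (Suc i)
    then obtain y where y: "\<forall>j. Q j (y j)" "\<forall>k<i. P k y" by auto
    from step [of i y] y(1) Suc.prems obtain v where v: "Q (i + l) v" "P i (y(i + l := v))"
      by auto
    have "P k (y(i + l := v))" if "k < Suc i" for k
    proof (cases "k = i")
      case False
      then have "k < i" using that by simp
      then have "P k y" using y(2) by simp
      then show ?thesis by (rule loc [of k y, rotated]) (use \<open>k < i\<close> in simp)
    qed (use v in simp)
    moreover have "Q j ((y(i + l := v)) j)" for j using y(1) v(1) by simp
    ultimately show ?case by blast
  qed
  from this [of K] show ?thesis by simp
qed

text \<open>Equation k is solved for x k by dividing by the following l entries. Only x 0 may become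
  zero: it is chosen last and occurs in no product other than that for k = 0.\<close>

lemma consecutive_products_backward:
  fixes w :: "nat \<Rightarrow> 'a::field"
  assumes w: "\<And>k. 0 < k \<Longrightarrow> k < K \<Longrightarrow> w k \<noteq> 0"
  shows "\<exists>x. (\<forall>j>0. x j \<noteq> 0) \<and> (\<forall>k<K. (\<Prod>i\<le>l. x (k + i)) = w k)"
proof -
  have "\<exists>x. (\<forall>j. 0 < j \<longrightarrow> x j \<noteq> 0) \<and> (\<forall>k<K. (\<Prod>i\<le>l. x (k + i)) = w k)"
  proof (rule solve_backward)
    fix k and x :: "nat \<Rightarrow> 'a" assume k: "k < K" and x: "\<And>j. 0 < j \<longrightarrow> x j \<noteq> 0"
    define c where "c = (\<Prod>i<l. x (k + Suc i))"
    have "c \<noteq> 0" using x by (simp add: c_def)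
    have "(\<Prod>i\<le>l. (x(k := v)) (k + i)) = v * c" for v
      by (cases l) (simp_all add: c_def prod.atMost_Suc_shift lessThan_Suc_atMost
          del: prod.atMost_Suc)
    with \<open>c \<noteq> 0\<close> w [of k] k
    show "\<exists>v. (0 < k \<longrightarrow> v \<noteq> 0) \<and> (\<Prod>i\<le>l. (x(k := v)) (k + i)) = w k"
      by (intro exI [of _ "w k / c"]) simp
  next
    fix k and x x' :: "nat \<Rightarrow> 'a" assume "\<And>j. k \<le> j \<Longrightarrow> x j = x' j" "(\<Prod>i\<le>l. x (k + i)) = w k"
    then show "(\<Prod>i\<le>l. x' (k + i)) = w k" by simp
  qed (rule exI [of _ 1], simp)
  then show ?thesis by simp
qed

text \<open>Equation k is solved for x (k + l). A zero is tolerated only in the last unknown x (K +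
  l - 1), by which no later equation divides.\<close>

lemma consecutive_products_forward:
  fixes w :: "nat \<Rightarrow> 'a::field"
  assumes w: "\<And>k. Suc k < K \<Longrightarrow> w k \<noteq> 0"
  shows "\<exists>x. (\<forall>j. Suc j < K + l \<longrightarrow> x j \<noteq> 0) \<and> (\<forall>k<K. (\<Prod>i\<le>l. x (k + i)) = w k)"
proof (rule solve_forward [where l = l])
  fix k and x :: "nat \<Rightarrow> 'a" assume k: "k < K" and x: "\<And>j. Suc j < K + l \<longrightarrow> x j \<noteq> 0"
  define c where "c = (\<Prod>i<l. x (k + i))"
  have "c \<noteq> 0" using x k by (simp add: c_def)
  have "(\<Prod>i\<le>l. (x(k + l := v)) (k + i)) = c * v" for v
    by (simp add: c_def flip: lessThan_Suc_atMost)
  with \<open>c \<noteq> 0\<close> w [of k] k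
  show "\<exists>v. (Suc (k + l) < K + l \<longrightarrow> v \<noteq> 0) \<and> (\<Prod>i\<le>l. (x(k + l := v)) (k + i)) = w k"
    by (intro exI [of _ "w k / c"]) simp
next
  fix k and x x' :: "nat \<Rightarrow> 'a"
  assume "\<And>j. j \<le> k + l \<Longrightarrow> x j = x' j" "(\<Prod>i\<le>l. x (k + i)) = w k"
  then show "(\<Prod>i\<le>l. x' (k + i)) = w k" by simp
qed (rule exI [of _ 1], simp)

text \<open>Back substitution with the pivots \<alpha> k 0.\<close>

lemma banded_system_backward:
  fixes z :: "nat \<Rightarrow> 'a::field"
  assumes "\<And>k. k < K \<Longrightarrow> \<alpha> k 0 \<noteq> 0"
  shows "\<exists>y. \<forall>k<K. (\<Sum>i\<le>l. \<alpha> k i * y (k + i)) = z k"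
proof -
  have "\<exists>y. (\<forall>j::nat. True) \<and> (\<forall>k<K. (\<Sum>i\<le>l. \<alpha> k i * y (k + i)) = z k)"
  proof (rule solve_backward)
    fix k and y :: "nat \<Rightarrow> 'a" assume k: "k < K"
    define c where "c = (\<Sum>i<l. \<alpha> k (Suc i) * y (k + Suc i))"
    have "(\<Sum>i\<le>l. \<alpha> k i * (y(k := v)) (k + i)) = \<alpha> k 0 * v + c" for v
      by (cases l) (simp_all add: c_def sum.atMost_Suc_shift lessThan_Suc_atMost del: sum.atMost_Suc)
    with assms [OF k] show "\<exists>v. True \<and> (\<Sum>i\<le>l. \<alpha> k i * (y(k := v)) (k + i)) = z k"
      by (intro exI [of _ "(z k - c) / \<alpha> k 0"]) simp
  qed simp_all
  then show ?thesis by simp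
qed

text \<open>Forward substitution with the pivots \<alpha> k l.\<close>

lemma banded_system_forward:
  fixes z :: "nat \<Rightarrow> 'a::field"
  assumes "\<And>k. k < K \<Longrightarrow> \<alpha> k l \<noteq> 0"
  shows "\<exists>y. \<forall>k<K. (\<Sum>i\<le>l. \<alpha> k i * y (k + i)) = z k"
proof -
  have "\<exists>y. (\<forall>j::nat. True) \<and> (\<forall>k<K. (\<Sum>i\<le>l. \<alpha> k i * y (k + i)) = z k)"
  proof (rule solve_forward [where l = l])
    fix k and y :: "nat \<Rightarrow> 'a" assume k: "k < K"
    define c where "c = (\<Sum>i<l. \<alpha> k i * y (k + i))"
    have "(\<Sum>i\<le>l. \<alpha> k i * (y(k + l := v)) (k + i)) = c + \<alpha> k l * v" for v
      by (simp add: c_def flip: lessThan_Suc_atMost)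
    with assms [OF k] show "\<exists>v. True \<and> (\<Sum>i\<le>l. \<alpha> k i * (y(k + l := v)) (k + i)) = z k"
      by (intro exI [of _ "(z k - c) / \<alpha> k l"]) simp
  qed simp_all
  then show ?thesis by simp
qed

section \<open>Successive approximation of a solution\<close>

lemma lev_SucI:
  "A \<in> lev m d \<Longrightarrow> (\<And>k. k + d < m \<Longrightarrow> diag A d k = 0) \<Longrightarrow> A \<in> lev m (Suc d)"
  by (auto simp: lev_def less_Suc_eq)

lemma utm_value_1_lev:
  "\<forall>(e, G)\<in>set us. G - 1 \<in> lev m q \<Longrightarrow> utm_value us 1 - 1 \<in> lev m q"
proof (induction us)
  case (Cons u us)
  obtain e G where u: "u = (e, G)" by (cases u)
  have "utm_value (u # us) 1 - 1 = (G - 1) * utm_value us 1 + (utm_value us 1 - 1)"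
    by (simp add: u algebra_simps)
  moreover have "(G - 1) * utm_value us 1 + (utm_value us 1 - 1) \<in> lev m q"
    using Cons u by (intro lev_add lev_mult_right) auto
  ultimately show ?case by (simp only:)
qed simp

text \<open>Here \<open>Suc l\<close> is q. Since u(T) - T^(qr) reacts to a change of T only q
  superdiagonals further on, the leading change of u(T) is that of T^(qr) = (1 + X^q)^r for T = 1 +
  X. The hypothesis \<open>nz\<close> leaves only the first or the last entry of superdiagonal q of
  u(1) free to vanish.\<close>

lemma utm_equation_solvable:
  fixes us :: "(nat \<times> 'a::field utm) list"
  assumes p: "prime p" "of_nat p = (0 :: 'a)" and l: "Suc l = p ^ s"
    and ex: "sum_list (map fst us) = Suc l * r" and r: "of_nat r \<noteq> (0 :: 'a)"
    and G: "\<forall>(e, G)\<in>set us. G - 1 \<in> lev m (Suc l)"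
    and nz: "(\<forall>k. 0 < k \<longrightarrow> k + Suc l < m \<longrightarrow> diag (utm_value us 1) (Suc l) k \<noteq> 0)
      \<or> (\<forall>k. Suc k + Suc l < m \<longrightarrow> diag (utm_value us 1) (Suc l) k \<noteq> 0)"
  shows "\<exists>T. T - 1 \<in> lev m 1 \<and> utm_value us T - 1 \<in> lev m m"
proof -
  define a where "a = diag (utm_value us 1) (Suc l)"
  \<comment> \<open>On superdiagonal q the value at 1 + X0 is a k plus r times the product of x k,
    ..., x (k + l); this choice of the product cancels it.\<close>
  define w where "w k = - a k / of_nat r" for k
  \<comment> \<open>The possible zero of x is x 0 in the first case and x (m - 2), the last entry of
    superdiagonal 1, in the second.\<close>
  obtain x where x: "(\<forall>j>0. x j \<noteq> 0) \<or> (\<forall>j. Suc (Suc j) < m \<longrightarrow> x j \<noteq> 0)"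
    and xw: "\<And>k. k + Suc l < m \<Longrightarrow> (\<Prod>i\<le>l. x (k + i)) = w k"
    using nz
  proof
    assume "\<forall>k. 0 < k \<longrightarrow> k + Suc l < m \<longrightarrow> diag (utm_value us 1) (Suc l) k \<noteq> 0"
    then have "\<And>k. 0 < k \<Longrightarrow> k < m - Suc l \<Longrightarrow> w k \<noteq> 0" using r by (simp add: w_def a_def)
    from consecutive_products_backward [of "m - Suc l" w l, OF this]
    obtain x where "\<forall>j>0. x j \<noteq> 0" "\<forall>k<m - Suc l. (\<Prod>i\<le>l. x (k + i)) = w k" by blast
    then show thesis by (intro that [of x] disjI1) (simp_all add: less_diff_conv)
  next
    assume "\<forall>k. Suc k + Suc l < m \<longrightarrow> diag (utm_value us 1) (Suc l) k \<noteq> 0"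
    then have "\<And>k. Suc k < m - Suc l \<Longrightarrow> w k \<noteq> 0" using r by (simp add: w_def a_def)
    from consecutive_products_forward [of "m - Suc l" w l, OF this]
    obtain x where x: "\<forall>j. Suc j < m - Suc l + l \<longrightarrow> x j \<noteq> 0"
      "\<forall>k<m - Suc l. (\<Prod>i\<le>l. x (k + i)) = w k" by blast
    show thesis
    proof (cases "m \<le> Suc l")
      case True
      then show ?thesis by (intro that [of "\<lambda>_. 1"]) auto
    next
      case False
      with x show ?thesis by (intro that [of x] disjI2) (simp_all add: less_diff_conv)
    qed
  qed
  have pw: "(1 + Z) ^ Suc l = 1 + Z ^ Suc l" for Z :: "'a utm"
    unfolding l by (rule one_plus_power_prime_power [OF p(1) of_nat_utm_eq_0 [OF p(2)]])

  define X0 where "X0 = UTM (\<lambda>d k. if d = 1 then x k else 0)"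
  have X0: "X0 \<in> lev m 1" by (simp add: X0_def lev_def)
  have init: "utm_value us (1 + X0) - 1 \<in> lev m (Suc (Suc l))"
  proof -
    have XP: "X0 ^ Suc l \<in> lev m (Suc l)" by (rule lev_power [OF X0])
    \<comment> \<open>Comparison with T = 1: apart from the power of T, superdiagonal q of the value
      is still that of u(1).\<close>
    have d1: "(utm_value us (1 + X0) - (1 + X0) ^ (Suc l * r)) - (utm_value us 1 - 1) \<in> lev m (Suc (Suc l))"
      using utm_value_diff [OF _ G, of "1 + X0" 1 1] X0 by (simp add: ex)
    have d2: "(1 + X0 ^ Suc l) ^ r - 1 - of_nat r * X0 ^ Suc l \<in> lev m (Suc (Suc l))"
      using lev_power_diff [of "1 + X0 ^ Suc l" 1 m "Suc l" r] XP lev_mono [OF XP, of 1] by simp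
    have d3: "utm_value us 1 - 1 + of_nat r * X0 ^ Suc l \<in> lev m (Suc (Suc l))"
    proof (rule lev_SucI)
      show "utm_value us 1 - 1 + of_nat r * X0 ^ Suc l \<in> lev m (Suc l)"
        using XP utm_value_1_lev [OF G] by (simp add: lev_add lev_of_nat_mult)
      fix k assume k: "k + Suc l < m"
      have "diag (X0 ^ Suc l) (Suc l) k = (\<Prod>j<Suc l. diag X0 1 (k + j))"
        by (rule diag_power_lead [OF X0 k])
      also have "\<dots> = w k" using xw [OF k] by (simp add: X0_def lessThan_Suc_atMost)
      finally show "diag (utm_value us 1 - 1 + of_nat r * X0 ^ Suc l) (Suc l) k = 0"
        using r by (simp add: diag_of_nat_mult w_def a_def del: power_Suc)
    qed
    have "a - 1 = ((a - b) - (c - 1)) + (b - 1 - e) + (c - 1 + e)" for a b c e :: "'a utm"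
      by (simp add: algebra_simps)
    from this [of "utm_value us (1 + X0)"] have "utm_value us (1 + X0) - 1 =
        ((utm_value us (1 + X0) - (1 + X0) ^ (Suc l * r)) - (utm_value us 1 - 1)) +
        ((1 + X0 ^ Suc l) ^ r - 1 - of_nat r * X0 ^ Suc l) +
        (utm_value us 1 - 1 + of_nat r * X0 ^ Suc l)"
      unfolding power_mult pw .
    with d1 d2 d3 show ?thesis by (simp only: lev_add)
  qed

  \<comment> \<open>Superdiagonal 1 stays fixed throughout, because the coefficients of all later
    linear systems are built from it.\<close>
  have "\<exists>X. X \<in> lev m 1 \<and> (\<forall>k. k + 1 < m \<longrightarrow> diag X 1 k = x k) \<and>
      utm_value us (1 + X) - 1 \<in> lev m d" if "d \<ge> Suc (Suc l)" for d
    using that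
  proof (induction d rule: dec_induct)
    case base
    show ?case using X0 init by (intro exI [of _ X0]) (simp add: X0_def)
  next
    case (step d)
    then obtain X where X: "X \<in> lev m 1" "\<And>k. k + 1 < m \<Longrightarrow> diag X 1 k = x k"
      and uX: "utm_value us (1 + X) - 1 \<in> lev m d" by auto
    \<comment> \<open>One factor \<open>Y\<close> on superdiagonal D and l factors \<open>X\<close>
      together reach superdiagonal d. As d \<ge> l + 2, the correction leaves superdiagonal 1
      alone.\<close>
    define D where "D = d - l"
    have D: "D \<ge> 2" "d = D + l" using step.hyps by (simp_all add: D_def)
    \<comment> \<open>The coefficient of y (k + i) in the entry (k, k + d): i unit steps by
      \<open>X\<close>, a jump of length D by \<open>Y\<close>, then l - i unit steps by
      \<open>X\<close>.\<close>
    define \<alpha> where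
      "\<alpha> k i = of_nat r * (\<Prod>j<i. x (k + j)) * (\<Prod>j<l - i. x (k + i + D + j))" for k i
    obtain y where y: "\<And>k. k + d < m \<Longrightarrow>
        (\<Sum>i\<le>l. \<alpha> k i * y (k + i)) = - diag (utm_value us (1 + X)) d k"
    proof -
      have "(\<forall>k<m - d. \<alpha> k 0 \<noteq> 0) \<or> (\<forall>k<m - d. \<alpha> k l \<noteq> 0)"
        using x
      proof
        assume "\<forall>j>0. x j \<noteq> 0"
        \<comment> \<open>Only x j with j \<ge> D occur here, so x 0 is avoided.\<close>
        then have "\<alpha> k 0 \<noteq> 0" for k using r D by (simp add: \<alpha>_def)
        then show ?thesis by simp
      next
        assume nz: "\<forall>j. Suc (Suc j) < m \<longrightarrow> x j \<noteq> 0"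
        have "\<alpha> k l \<noteq> 0" if "k < m - d" for k
        proof -
          \<comment> \<open>From k + D + l < m and D \<ge> 2 it follows that k + j < m - 2, so the
            last entry is avoided.\<close>
          have "x (k + j) \<noteq> 0" if "j < l" for j using nz \<open>k < m - d\<close> that D by simp
          then show ?thesis using r by (simp add: \<alpha>_def)
        qed
        then show ?thesis by simp
      qed
      then have "\<exists>y. \<forall>k<m - d. (\<Sum>i\<le>l. \<alpha> k i * y (k + i)) = - diag (utm_value us (1 + X)) d k"
      proof
        assume "\<forall>k<m - d. \<alpha> k 0 \<noteq> 0"
        then show ?thesis by (intro banded_system_backward) simp
      next
        assume "\<forall>k<m - d. \<alpha> k l \<noteq> 0"
        then show ?thesis by (intro banded_system_forward) simp
      qed
      then obtain y where "\<forall>k<m - d. (\<Sum>i\<le>l. \<alpha> k i * y (k + i)) = - diag (utm_value us (1 + X)) d k" ..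
      then show ?thesis by (intro that [of y]) (simp add: less_diff_conv)
    qed
    define Y where "Y = UTM (\<lambda>e k. if e = D then y k else 0)"
    have Y: "Y \<in> lev m D" by (simp add: Y_def lev_def)
    have XY: "X + Y \<in> lev m 1" using lev_mono [OF Y, of 1] D by (intro lev_add X) simp
    define S where "S = (\<Sum>i\<le>l. X ^ i * Y * X ^ (l - i))"
    have S_lev: "X ^ i * Y * X ^ (l - i) \<in> lev m d" if "i \<le> l" for i
      using lev_mult [OF lev_mult [OF lev_power [OF X(1), of i] Y] lev_power [OF X(1), of "l - i"]]
        that by (simp add: D ac_simps)
    then have S: "S \<in> lev m d" unfolding S_def by (intro lev_sum) simp
    have Sk: "of_nat r * diag S d k = - diag (utm_value us (1 + X)) d k" if k: "k + d < m" for k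
    proof -
      have "of_nat r * diag (X ^ i * Y * X ^ (l - i)) d k = \<alpha> k i * y (k + i)" if i: "i \<le> l" for i
      proof -
        have d: "d = (i + D) + (l - i)" using i D by simp
        have "diag (X ^ i * Y * X ^ (l - i)) ((i + D) + (l - i)) k =
            diag (X ^ i * Y) (i + D) k * diag (X ^ (l - i)) (l - i) (k + (i + D))"
          using k i D
          by (intro diag_mult_lead [OF lev_mult [OF lev_power [OF X(1)] Y] lev_power [OF X(1)]]) simp
        also have "diag (X ^ i * Y) (i + D) k = diag (X ^ i) i k * diag Y D (k + i)"
          using k i D by (intro diag_mult_lead [OF lev_power [OF X(1)] Y]) auto
        also have "diag (X ^ i) i k = (\<Prod>j<i. diag X 1 (k + j))"
          using k i D by (intro diag_power_lead [OF X(1)]) simp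
        also have "\<dots> = (\<Prod>j<i. x (k + j))"
          using k i D by (intro prod.cong X(2)) auto
        also have "diag (X ^ (l - i)) (l - i) (k + (i + D)) = (\<Prod>j<l - i. diag X 1 (k + (i + D) + j))"
          using k i D by (intro diag_power_lead [OF X(1)]) simp
        also have "\<dots> = (\<Prod>j<l - i. x (k + i + D + j))"
          using k i D by (intro prod.cong) (simp_all add: X(2) [unfolded One_nat_def] add.assoc)
        finally show ?thesis unfolding d [symmetric] by (simp add: \<alpha>_def Y_def ac_simps)
      qed
      then show ?thesis using y [OF k] by (simp add: S_def diag_sum sum_distrib_left)
    qed
    define A B where "A = (1 + (X + Y)) ^ Suc l" and "B = (1 + X) ^ Suc l"
    have AB: "A - B - S \<in> lev m (Suc d)"
      unfolding A_def B_def pw S_def D(2) using power_perturb [OF X(1) Y D(1), of l]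
      by (simp add: algebra_simps)
    have AB': "A - B \<in> lev m d"
      using lev_add [OF lev_mono [OF AB, of d] S] by simp
    have A1: "A - 1 \<in> lev m 1" "B - 1 \<in> lev m 1"
      unfolding A_def B_def pw using lev_mono [OF lev_power [OF XY, of "Suc l"], of 1]
        lev_mono [OF lev_power [OF X(1), of "Suc l"], of 1] by simp_all
    have d1: "(utm_value us (1 + (X + Y)) - A ^ r) - (utm_value us (1 + X) - B ^ r) \<in> lev m (Suc d)"
      using utm_value_diff [OF _ G, of "1 + (X + Y)" "1 + X" D] Y
      unfolding A_def B_def by (simp add: ex D flip: power_mult del: power_Suc)
    have d2: "A ^ r - B ^ r - of_nat r * (A - B) \<in> lev m (Suc d)"
      by (rule lev_power_diff [OF AB' A1])
    have d3: "utm_value us (1 + X) - 1 + of_nat r * S \<in> lev m (Suc d)"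
    proof (rule lev_SucI)
      show "utm_value us (1 + X) - 1 + of_nat r * S \<in> lev m d"
        using uX S by (simp add: lev_add lev_of_nat_mult)
      show "diag (utm_value us (1 + X) - 1 + of_nat r * S) d k = 0" if "k + d < m" for k
        using Sk [OF that] D by (simp add: diag_of_nat_mult)
    qed
    \<comment> \<open>The summands are the change of u(T) - T^(qr), the nonlinear parts of the r-th
      and of the q-th power, and the old error corrected by r S, which was made to vanish on
      superdiagonal d.\<close>
    have "utm_value us (1 + (X + Y)) - 1 =
        ((utm_value us (1 + (X + Y)) - A ^ r) - (utm_value us (1 + X) - B ^ r)) +
        (A ^ r - B ^ r - of_nat r * (A - B)) + of_nat r * (A - B - S) +
        (utm_value us (1 + X) - 1 + of_nat r * S)"
      by (simp add: right_diff_distrib)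
    then have "utm_value us (1 + (X + Y)) - 1 \<in> lev m (Suc d)"
      using d1 d2 d3 lev_of_nat_mult [OF AB] by (simp only: lev_add)
    moreover have "diag (X + Y) 1 k = x k" if "k + 1 < m" for k
      using X(2) [OF that] D by (simp add: Y_def)
    ultimately show ?case using XY by blast
  qed
  from this [of "m + Suc (Suc l)"] obtain X
    where "X \<in> lev m 1" "utm_value us (1 + X) - 1 \<in> lev m (m + Suc (Suc l))" by auto
  then show ?thesis by (intro exI [of _ "1 + X"]) (auto intro: lev_mono)
qed

subsection \<open>Truncation to finite matrices\<close>

definition trunc :: "nat \<Rightarrow> 'a::ring_1 utm \<Rightarrow> 'a mat" where
  "trunc m A = mat m m (\<lambda>(i, j). if i \<le> j then diag A (j - i) i else 0)"

lemma trunc_carrier [simp]: "trunc m A \<in> carrier_mat m m"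
  by (simp add: trunc_def)

lemma trunc_dim [simp]: "dim_row (trunc m A) = m" "dim_col (trunc m A) = m"
  by (simp_all add: trunc_def)

lemma trunc_index: "i < m \<Longrightarrow> j < m \<Longrightarrow> trunc m A $$ (i, j) = (if i \<le> j then diag A (j - i) i else 0)"
  by (simp add: trunc_def)

lemma trunc_1: "trunc m 1 = 1\<^sub>m m"
  by (rule eq_matI) (auto simp: trunc_index)

lemma trunc_mult: "trunc m (A * B) = trunc m A * trunc m B"
proof (rule eq_matI)
  fix i j assume "i < dim_row (trunc m A * trunc m B)" "j < dim_col (trunc m A * trunc m B)"
  then have ij: "i < m" "j < m" by simp_all
  have "(trunc m A * trunc m B) $$ (i, j) =
      (\<Sum>k=0..<m. (if i \<le> k then diag A (k - i) i else 0) * (if k \<le> j then diag B (j - k) k else 0))"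
    using ij by (simp add: scalar_prod_def trunc_index)
  also have "\<dots> = (\<Sum>k\<in>{i..j}. diag A (k - i) i * diag B (j - k) k)"
    using ij by (intro sum.mono_neutral_cong_right) auto
  also have "\<dots> = trunc m (A * B) $$ (i, j)"
  proof (cases "i \<le> j")
    case True
    have "(\<Sum>k\<in>{i..j}. diag A (k - i) i * diag B (j - k) k) =
        (\<Sum>e=0..j - i. diag A e i * diag B (j - i - e) (i + e))"
      using True
      by (intro sum.reindex_bij_witness [of _ "\<lambda>e. i + e" "\<lambda>k. k - i"]) auto
    with True ij show ?thesis by (simp add: trunc_index diag_mult)
  qed (use ij in \<open>simp add: trunc_index\<close>)
  finally show "trunc m (A * B) $$ (i, j) = (trunc m A * trunc m B) $$ (i, j)" ..
qed simp_all

lemma trunc_eqI: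
  assumes "A - B \<in> lev m m"
  shows "trunc m A = trunc m B"
proof -
  have "diag A (j - i) i = diag B (j - i) i" if "i \<le> j" "j < m" for i j
    using levD [OF assms, of "j - i" i] that by simp
  then show ?thesis by (intro eq_matI) (auto simp: trunc_index)
qed

lemma UT_simps [simp]:
  "mult (UT m) = (*)" "one (UT m) = 1\<^sub>m m"
  by (simp_all add: UT_def)

lemma UT_iff: "A \<in> carrier (UT m) \<longleftrightarrow>
    A \<in> carrier_mat m m \<and> (\<forall>i<m. \<forall>j<i. A $$ (i, j) = 0) \<and> (\<forall>i<m. A $$ (i, i) = 1)"
  by (auto simp: UT_def upper_triangular_def)

lemma trunc_UT:
  assumes "T - 1 \<in> lev m 1"
  shows "trunc m T \<in> carrier (UT m)"
proof -
  have "diag T 0 i = 1" if "i < m" for i using levD [OF assms, of 0 i] that by simp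
  then show ?thesis by (simp add: UT_iff trunc_index)
qed

lemma UT_truncE:
  assumes "A \<in> carrier (UT m)"
  obtains T where "T - 1 \<in> lev m 1" "A = trunc m T"
proof
  \<comment> \<open>Positions outside the block of size m receive unspecified entries, which
    \<open>lev m 1\<close> does not see.\<close>
  define T where "T = UTM (\<lambda>d k. A $$ (k, k + d))"
  show "T - 1 \<in> lev m 1" using assms by (simp add: T_def lev_def UT_iff)
  show "A = trunc m T" using assms by (intro eq_matI) (auto simp: T_def trunc_index UT_iff)
qed

lemma UT_mult_closed:
  assumes "A \<in> carrier (UT m)" "B \<in> carrier (UT m)"
  shows "A * B \<in> carrier (UT m)"
proof -
  obtain S T where S: "S - 1 \<in> lev m 1" "A = trunc m S" and T: "T - 1 \<in> lev m 1" "B = trunc m T"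
    using assms UT_truncE by metis
  have "(S - 1) * T + (T - 1) \<in> lev m 1" using S T by (intro lev_add lev_mult_right)
  then have "S * T - 1 \<in> lev m 1" by (simp add: algebra_simps)
  from trunc_UT [OF this] show ?thesis by (simp add: S T trunc_mult)
qed

lemma monoid_UT: "monoid (UT m :: 'a::field mat monoid)"
proof
  show "\<one>\<^bsub>UT m\<^esub> \<in> carrier (UT m :: 'a mat monoid)" by (simp add: UT_iff)
  fix A B C :: "'a mat"
  assume A: "A \<in> carrier (UT m)" and B: "B \<in> carrier (UT m)" and C: "C \<in> carrier (UT m)"
  show "A \<otimes>\<^bsub>UT m\<^esub> B \<in> carrier (UT m)" using A B by (simp add: UT_mult_closed)
  show "A \<otimes>\<^bsub>UT m\<^esub> B \<otimes>\<^bsub>UT m\<^esub> C = A \<otimes>\<^bsub>UT m\<^esub> (B \<otimes>\<^bsub>UT m\<^esub> C)"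
    using A B C by (auto simp: UT_iff)
qed (auto simp: UT_iff)

lemma trunc_power: "trunc m (T ^ k) = trunc m T [^]\<^bsub>UT m\<^esub> k"
  for T :: "'a::field utm"
  by (induction k) (simp_all add: trunc_1 trunc_mult power_Suc2 nat_pow_def del: power_Suc)

text \<open>With N = T - 1 the power is 1 + N^(p^t), and N^i lies in \<open>lev m m\<close> as soon
  as i \<ge> m.\<close>

lemma UT_power_eq_one:
  fixes A :: "'a::field mat"
  assumes p: "prime p" "of_nat p = (0 :: 'a)" and A: "A \<in> carrier (UT m)" and t: "m \<le> p ^ t"
  shows "A [^]\<^bsub>UT m\<^esub> (p ^ t) = 1\<^sub>m m"
proof -
  obtain T where T: "T - 1 \<in> lev m 1" "A = trunc m T" using A UT_truncE by metis
  have "(1 + (T - 1)) ^ p ^ t = 1 + (T - 1) ^ p ^ t"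
    by (rule one_plus_power_prime_power [OF p(1) of_nat_utm_eq_0 [OF p(2)]])
  moreover have "(T - 1) ^ p ^ t \<in> lev m m"
    by (rule lev_mono [OF lev_power [OF T(1)] t])
  ultimately have "T ^ p ^ t - 1 \<in> lev m m" by simp
  from trunc_eqI [OF this] show ?thesis by (simp add: T trunc_1 flip: trunc_power)
qed

text \<open>Inverses come from finite order: the power with exponent p^m - 1 is a left inverse, as m
  < p^m.\<close>

lemma group_UT:
  assumes p: "prime p" "of_nat p = (0 :: 'a::field)"
  shows "group (UT m :: 'a mat monoid)"
proof -
  interpret monoid "UT m :: 'a mat monoid" by (rule monoid_UT)
  show ?thesis
  proof (rule group_l_invI)
    fix A :: "'a mat" assume A: "A \<in> carrier (UT m)"
    have "m < p ^ m" using prime_gt_1_nat [OF p(1)] by (intro power_gt_expt) simp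
    then have "Suc (p ^ m - 1) = p ^ m" by simp
    then have "A [^]\<^bsub>UT m\<^esub> Suc (p ^ m - 1) = \<one>\<^bsub>UT m\<^esub>"
      using UT_power_eq_one [OF p A, of m] \<open>m < p ^ m\<close> by (simp only: UT_simps less_imp_le)
    then have "(A [^]\<^bsub>UT m\<^esub> (p ^ m - 1)) \<otimes>\<^bsub>UT m\<^esub> A = \<one>\<^bsub>UT m\<^esub>" by (simp only: nat_pow_Suc)
    then show "\<exists>B\<in>carrier (UT m). B \<otimes>\<^bsub>UT m\<^esub> A = \<one>\<^bsub>UT m\<^esub>" using A nat_pow_closed by blast
  qed
qed

lemma (in group) int_pow_mod:
  assumes x: "x \<in> carrier G" and P: "x [^] (P :: nat) = \<one>" "P > 0"
  shows "x [^] (e :: int) = x [^] nat (e mod int P)"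
proof -
  have "x [^] e = x [^] (int P * (e div int P) + e mod int P)" by simp
  also have "\<dots> = (x [^] int P) [^] (e div int P) \<otimes> x [^] (e mod int P)"
    using x by (simp only: int_pow_mult int_pow_pow int_pow_closed)
  also have "x [^] int P = \<one>" using P by (simp add: int_pow_int)
  also have "x [^] (e mod int P) = x [^] nat (e mod int P)"
    using P by (subst int_pow_int [symmetric]) simp
  finally show ?thesis using x by simp
qed

subsection \<open>Block embeddings\<close>

text \<open>Row \<open>k\<close> of the large matrix belongs to the block \<open>b k\<close> and plays there the role of row \<open>c k\<close> of
  the small matrix.\<close>

locale block_embedding =
  fixes n m :: nat and b c :: "nat \<Rightarrow> nat"
  assumes c_less: "k < m \<Longrightarrow> c k < n"
    and c_mono: "k < l \<Longrightarrow> l < m \<Longrightarrow> b k = b l \<Longrightarrow> c k < c l"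
    and c_onto: "k < l \<Longrightarrow> l < m \<Longrightarrow> b k = b l \<Longrightarrow> c k < i \<Longrightarrow> i < c l \<Longrightarrow> \<exists>j<m. b j = b k \<and> c j = i"
    and full_block: "\<exists>\<beta>. \<forall>i<n. \<exists>k<m. b k = \<beta> \<and> c k = i"
begin

text \<open>Outside the block of size m the entries are those of the identity; thus
  \<open>block\<close> is multiplicative exactly, not only modulo \<open>lev m m\<close>.\<close>

definition block :: "'a::ring_1 mat \<Rightarrow> 'a utm" where
  "block g = UTM (\<lambda>d k. if d = 0 then 1
     else if k + d < m \<and> b k = b (k + d) then g $$ (c k, c (k + d)) else 0)"

lemma diag_block: "diag (block g) d k = (if d = 0 then 1
     else if k + d < m \<and> b k = b (k + d) then g $$ (c k, c (k + d)) else 0)"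
  by (simp add: block_def)

lemma block_lev: "block g - 1 \<in> lev m 1"
  by (simp add: lev_def diag_block)

lemma diag_block': "g \<in> carrier (UT n) \<Longrightarrow> k + d < m \<Longrightarrow> b k = b (k + d) \<Longrightarrow>
    diag (block g) d k = g $$ (c k, c (k + d))"
  using c_less by (simp add: diag_block UT_iff)

lemma block_one: "block (1\<^sub>m n) = 1"
proof (rule utm_eqI)
  fix d k
  show "diag (block (1\<^sub>m n)) d k = diag 1 d k"
    using c_mono [of k "k + d"] c_less [of k] c_less [of "k + d"] by (cases "d = 0") (auto simp: diag_block)
qed

text \<open>The indices from k to k + d in the block of k are mapped by \<open>c\<close> bijectively
  onto the interval from c k to c (k + d), outside which the terms of the small product
  vanish.\<close>

lemma block_mult:
  fixes g h :: "'a::field mat"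
  assumes g: "g \<in> carrier (UT n)" and h: "h \<in> carrier (UT n)"
  shows "block (g * h) = block g * block h"
proof (rule utm_eqI)
  fix d k :: nat
  let ?l = "k + d"
  consider "d = 0" | "d > 0" "?l < m" "b k = b ?l" | "d > 0" "\<not> (?l < m \<and> b k = b ?l)" by blast
  then show "diag (block (g * h)) d k = diag (block g * block h) d k"
  proof cases
    case 1 then show ?thesis by (simp add: diag_mult diag_block)
  next
    case 3
    have "diag (block g) e k * diag (block h) (d - e) (k + e) = 0" if "e \<in> {0..d}" for e
      using 3 that by (auto simp: diag_block)
    then have "diag (block g * block h) d k = 0" unfolding diag_mult by (intro sum.neutral) blast
    with 3 show ?thesis by (auto simp: diag_block)
  next
    case 2
    have ck: "c k < c ?l" "c ?l < n" using 2 by (simp_all add: c_mono c_less)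
    define E where "E = {e \<in> {0..d}. b (k + e) = b k}"
    have inj: "inj_on (\<lambda>e. c (k + e)) E"
    proof (rule linorder_inj_onI)
      fix e e' assume "e < e'" "e \<in> E" "e' \<in> E"
      then have "c (k + e) < c (k + e')" using 2 by (intro c_mono) (auto simp: E_def)
      then show "c (k + e) \<noteq> c (k + e')" by simp
    qed auto
    have img: "(\<lambda>e. c (k + e)) ` E = {c k..c ?l}"
    proof (intro equalityI subsetI)
      fix i assume "i \<in> (\<lambda>e. c (k + e)) ` E"
      then obtain e where e: "e \<le> d" "b (k + e) = b k" "i = c (k + e)" by (auto simp: E_def)
      have "c k \<le> c (k + e)" using c_mono [of k "k + e"] e 2 by (cases "e = 0") auto
      moreover have "c (k + e) \<le> c ?l" using c_mono [of "k + e" ?l] e 2 by (cases "e = d") auto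
      ultimately show "i \<in> {c k..c ?l}" using e by simp
    next
      fix i assume i: "i \<in> {c k..c ?l}"
      consider (left) "i = c k" | (right) "i = c ?l" | (mid) "c k < i" "i < c ?l" using i by fastforce
      then show "i \<in> (\<lambda>e. c (k + e)) ` E"
      proof cases
        case left then show ?thesis by (intro image_eqI [of _ _ 0]) (simp_all add: E_def)
      next
        case right then show ?thesis using 2 by (intro image_eqI [of _ _ d]) (simp_all add: E_def)
      next
        case mid
        then obtain j where j: "j < m" "b j = b k" "c j = i" using c_onto [of k ?l i] 2 by auto
        \<comment> \<open>\<open>c_onto\<close> does not locate j; monotonicity of \<open>c\<close>
          on the block forces it between k and k + d.\<close>
        have "k \<noteq> j" "j \<noteq> ?l" using j mid by auto
        moreover have "\<not> j < k" "\<not> ?l < j"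
          using c_mono [of j k] c_mono [of ?l j] j mid 2 by linarith+
        ultimately have "k < j" "j < ?l" by linarith+
        show ?thesis
          using j \<open>k < j\<close> \<open>j < ?l\<close> by (intro image_eqI [of _ _ "j - k"]) (simp_all add: E_def)
      qed
    qed
    have "diag (block g * block h) d k = (\<Sum>e\<in>E. g $$ (c k, c (k + e)) * h $$ (c (k + e), c ?l))"
      unfolding diag_mult
    proof (rule sum.mono_neutral_cong_right)
      show "\<forall>e\<in>{0..d} - E. diag (block g) e k * diag (block h) (d - e) (k + e) = 0"
      proof
        fix e assume "e \<in> {0..d} - E"
        then have "b k \<noteq> b (k + e)" by (auto simp: E_def)
        then have "diag (block g) e k = 0" unfolding diag_block by (cases "e = 0") simp_all
        then show "diag (block g) e k * diag (block h) (d - e) (k + e) = 0" by simp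
      qed
      fix e assume "e \<in> E"
      then have e: "e \<le> d" "b (k + e) = b k" by (simp_all add: E_def)
      then have "diag (block g) e k = g $$ (c k, c (k + e))"
        using 2 by (intro diag_block' [OF g]) simp_all
      moreover have "diag (block h) (d - e) (k + e) = h $$ (c (k + e), c (k + e + (d - e)))"
        using 2 e by (intro diag_block' [OF h]) simp_all
      ultimately show "diag (block g) e k * diag (block h) (d - e) (k + e) =
          g $$ (c k, c (k + e)) * h $$ (c (k + e), c ?l)"
        using e by simp
    qed (auto simp: E_def)
    also have "\<dots> = (\<Sum>i\<in>{c k..c ?l}. g $$ (c k, i) * h $$ (i, c ?l))"
      unfolding img [symmetric] by (simp add: sum.reindex [OF inj])
    also have "\<dots> = (\<Sum>i=0..<n. g $$ (c k, i) * h $$ (i, c ?l))"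
      using g h ck by (intro sum.mono_neutral_left) (auto simp: UT_iff)
    also have "\<dots> = (g * h) $$ (c k, c ?l)"
      using g h ck by (auto simp: UT_iff scalar_prod_def)
    finally show ?thesis using 2 by (simp add: diag_block)
  qed
qed

definition embed :: "'a::ring_1 mat \<Rightarrow> 'a mat" where
  "embed g = trunc m (block g)"

lemma embed_closed: "embed g \<in> carrier (UT m)"
  unfolding embed_def by (rule trunc_UT [OF block_lev])

text \<open>Injectivity comes from the full block, in which every entry of g above the diagonal
  reappears.\<close>

lemma embed_mon: "(embed :: 'a::field mat \<Rightarrow> _) \<in> mon (UT n) (UT m)"
proof -
  have "embed \<in> hom (UT n) (UT m :: 'a mat monoid)"
    by (rule homI) (simp_all add: embed_closed, simp add: embed_def block_mult trunc_mult)
  moreover have "inj_on embed (carrier (UT n :: 'a mat monoid))"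
  proof (rule inj_onI)
    fix g h :: "'a mat"
    assume g: "g \<in> carrier (UT n)" and h: "h \<in> carrier (UT n)" and eq: "embed g = embed h"
    from full_block obtain \<beta> where \<beta>: "\<forall>i<n. \<exists>k<m. b k = \<beta> \<and> c k = i" ..
    show "g = h"
    proof (rule eq_matI)
      fix i j assume "i < dim_row h" "j < dim_col h"
      then have ij: "i < n" "j < n" using h by (auto simp: UT_iff)
      show "g $$ (i, j) = h $$ (i, j)"
      proof (cases "i < j")
        case True
        from \<beta> ij obtain k l where k: "k < m" "b k = \<beta>" "c k = i" and l: "l < m" "b l = \<beta>" "c l = j"
          by metis
        have "k < l" using c_mono [of l k] k l True by (cases k l rule: linorder_cases) auto
        have "g $$ (i, j) = embed g $$ (k, l)" if "g \<in> carrier (UT n)" for g :: "'a mat"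
          using diag_block' [OF that, of k "l - k"] k l \<open>k < l\<close> by (simp add: embed_def trunc_index)
        with g h eq show ?thesis by simp
      next
        case False
        with g h ij show ?thesis by (cases "i = j") (auto simp: UT_iff)
      qed
    qed (use g h in \<open>auto simp: UT_iff\<close>)
  qed
  ultimately show ?thesis by (simp add: mon_def)
qed

text \<open>If \<open>P\<close> is a large power of \<open>p\<close>, then every \<open>P\<close>-th power in \<open>UT m\<close> is \<open>1\<close>, so that the integer
  exponents of an equation can be replaced by natural numbers.\<close>

definition utm_eqn :: "nat \<Rightarrow> 'a::ring_1 mat eqn \<Rightarrow> (nat \<times> 'a utm) list" where
  "utm_eqn P u = map (\<lambda>(e, g). (nat (e mod int P), block g)) u"

lemma utm_value_utm_eqn_1:
  fixes u :: "'a::field mat eqn"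
  assumes p: "prime p" "of_nat p = (0 :: 'a)" and u: "eqn_over (UT n) u"
  defines "a \<equiv> eqn_value (UT n) (\<lambda>g. g) u \<one>\<^bsub>UT n\<^esub>"
  shows "a \<in> carrier (UT n) \<and> utm_value (utm_eqn P u) 1 = block a"
  unfolding a_def using u
proof (induction u)
  case Nil
  show ?case by (simp add: eqn_value_def utm_eqn_def block_one UT_iff)
next
  case (Cons v u)
  interpret group "UT n :: 'a mat monoid" by (rule group_UT [OF p])
  obtain e g where v: "v = (e, g)" by (cases v)
  define a where "a = eqn_value (UT n) (\<lambda>g. g) u \<one>\<^bsub>UT n\<^esub>"
  have g: "g \<in> carrier (UT n)" using Cons.prems v by (simp add: eqn_over_def)
  have a: "a \<in> carrier (UT n)" "utm_value (utm_eqn P u) 1 = block a"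
    using Cons by (simp_all add: a_def eqn_over_def)
  have "eqn_value (UT n) (\<lambda>g. g) (v # u) \<one>\<^bsub>UT n\<^esub> = g * a"
    using g int_pow_one [of e] l_one [OF g]
    by (simp add: eqn_value_def v a_def)
  moreover have "utm_value (utm_eqn P (v # u)) 1 = block g * block a"
    using a by (simp add: utm_eqn_def v)
  ultimately show ?case using g a by (simp add: block_mult UT_mult_closed)
qed

text \<open>The way back to finite matrices: truncation is multiplicative, and p^t-th powers in
  \<open>UT m\<close> are 1, so the reduced exponents yield the original powers.\<close>

lemma solvable_in_embed:
  fixes u :: "'a::field mat eqn"
  assumes p: "prime p" "of_nat p = (0 :: 'a)" and t: "m \<le> p ^ t"
    and T: "T - 1 \<in> lev m 1" "utm_value (utm_eqn (p ^ t) u) T - 1 \<in> lev m m"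
  shows "solvable_in (UT m) embed u"
proof -
  interpret group "UT m :: 'a mat monoid" by (rule group_UT [OF p])
  have h: "trunc m T \<in> carrier (UT m)" by (rule trunc_UT [OF T(1)])
  have P: "trunc m T [^]\<^bsub>UT m\<^esub> (p ^ t) = \<one>\<^bsub>UT m\<^esub>" "p ^ t > 0"
    using UT_power_eq_one [OF p h t] prime_gt_0_nat [OF p(1)] by simp_all
  have "eqn_value (UT m) embed u (trunc m T) = trunc m (utm_value (utm_eqn (p ^ t) u) T)"
  proof (induction u)
    case Nil show ?case by (simp add: eqn_value_def utm_eqn_def trunc_1)
  next
    case (Cons v u)
    obtain e g where v: "v = (e, g)" by (cases v)
    show ?case using Cons int_pow_mod [OF h P, of e]
      by (simp add: eqn_value_def utm_eqn_def v trunc_mult trunc_power embed_def)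
  qed
  also have "\<dots> = 1\<^sub>m m" using trunc_eqI [OF T(2)] by (simp add: trunc_1)
  finally show ?thesis unfolding solvable_in_def using h by auto
qed

text \<open>Reduction modulo p^(s + m) turns the exponent into p^s (r + p^m z), and m > 0 keeps the
  second factor prime to p.\<close>

lemma utm_eqn_exponent:
  assumes p: "prime p" and ex: "eqn_exponent u = r * int p ^ s" and r: "coprime r (int p)"
    and m: "m > 0"
  obtains r' where "sum_list (map fst (utm_eqn (p ^ (s + m)) u)) = p ^ s * r'" "\<not> p dvd r'"
proof -
  define P where "P = p ^ (s + m)"
  have P: "P > 0" using prime_gt_0_nat [OF p] by (simp add: P_def)
  define N where "N = sum_list (map fst (utm_eqn P u))"
  have "int P dvd int (sum_list (map fst (utm_eqn P u))) - eqn_exponent u"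
  proof (induction u)
    case Nil show ?case by (simp add: utm_eqn_def eqn_exponent_def)
  next
    case (Cons v u)
    obtain e g where v: "v = (e, g)" by (cases v)
    have "int P dvd e mod int P - e" by (metis dvd_minus_mod dvd_minus_iff minus_diff_eq)
    from dvd_add [OF this Cons] show ?case
      using P by (simp add: v utm_eqn_def eqn_exponent_def algebra_simps)
  qed
  then obtain z where "int N - eqn_exponent u = int P * z" by (auto simp: N_def)
  then have N: "int N = int p ^ s * (r + int p ^ m * z)"
    by (simp add: ex P_def power_add algebra_simps)
  have p0: "int p ^ s > 0" using prime_gt_0_nat [OF p] by simp
  have "r + int p ^ m * z \<ge> 0" using N p0 by (metis of_nat_0_le_iff zero_le_mult_iff not_less)
  then obtain r' where r': "r + int p ^ m * z = int r'" using nonneg_int_cases by metis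
  have "N = p ^ s * r'" using N unfolding r' by (metis of_nat_eq_iff of_nat_mult of_nat_power)
  moreover have "\<not> p dvd r'"
  proof
    assume "p dvd r'"
    then have "int p dvd r + int p ^ m * z" unfolding r' by simp
    moreover have "int p dvd int p ^ m * z" using m by (intro dvd_mult2 dvd_power) auto
    ultimately have "int p dvd r" by (simp add: dvd_add_left_iff)
    with r have "is_unit (int p)" by (metis coprime_common_divisor dvd_refl)
    with p show False by (simp add: prime_gt_1_nat)
  qed
  ultimately show thesis by (intro that [of r']) (simp_all add: N_def P_def)
qed

end

lemma (in block_embedding) utm_eqn_lev:
  "(\<And>g :: 'a::ring_1 mat. block g - 1 \<in> lev m d) \<Longrightarrow> \<forall>(e, G)\<in>set (utm_eqn P u). G - 1 \<in> lev m d"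
  for u :: "'a::ring_1 mat eqn"
  by (auto simp: utm_eqn_def)

subsection \<open>Interleaved blocks\<close>

text \<open>Residue 0 is the full block. A residue \<rho> > 0 has n - 1 indices and acts through the
  upper left corner if \<rho> + t < q, otherwise through the lower right one; t = 0 and t = q - 1
  are the uniform choices.\<close>

lemma interleaved_block_embedding:
  assumes q: "t < (q :: nat)" and n: "n > 0" and m: "m = (n - 1) * q + 1"
  shows "block_embedding n m (\<lambda>k. k mod q) (\<lambda>k. (k + t) div q)"
proof
  fix k assume "k < m"
  then have "k + t < n * q" using q n m by (cases n) auto
  then show "(k + t) div q < n" by (simp add: less_mult_imp_div_less)
next
  fix k l assume kl: "k < l" "l < m" "k mod q = l mod q"
  have "q dvd l - k" using kl mod_eq_dvd_iff_nat [of k l q] by simp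
  then obtain z where "l - k = q * z" by (rule dvdE)
  with kl have l: "l + t = k + t + q * z" by linarith
  have "z > 0" using \<open>l - k = q * z\<close> kl by (cases z) simp_all
  have cl: "(l + t) div q = (k + t) div q + z" unfolding l using q by simp
  then show "(k + t) div q < (l + t) div q" using \<open>z > 0\<close> by simp
  fix i assume i: "(k + t) div q < i" "i < (l + t) div q"
  define y where "y = i - (k + t) div q"
  have "y < z" using i cl by (simp add: y_def)
  then have "q * y < q * z" using q by simp
  then have "k + q * y < l" using l by linarith
  moreover have "(k + q * y + t) div q = i"
  proof -
    have "(k + t + q * y) div q = (k + t) div q + y" using q by simp
    then show ?thesis using i by (simp add: y_def ac_simps)
  qed
  ultimately show "\<exists>j<m. j mod q = k mod q \<and> (j + t) div q = i"
    using kl by (intro exI [of _ "k + q * y"]) simp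
next
  show "\<exists>\<beta>. \<forall>i<n. \<exists>k<m. k mod q = \<beta> \<and> (k + t) div q = i"
  proof (rule exI [of _ 0], intro allI impI)
    fix i assume "i < n"
    then have "i * q \<le> (n - 1) * q" by (intro mult_right_mono) simp_all
    then have "i * q < m" unfolding m by linarith
    then show "\<exists>k<m. k mod q = 0 \<and> (k + t) div q = i"
      using q by (intro exI [of _ "i * q"]) simp
  qed
qed

text \<open>Indices of one block differ by multiples of q, so coefficients leave superdiagonals 1 to
  q - 1 empty, and superdiagonal q of u(1) repeats entries from the first superdiagonal of
  \<open>a\<close>.\<close>

lemma solvable_interleaved:
  fixes u :: "'a::field mat eqn"
  assumes p: "prime p" "\<And>k. of_nat k = (0 :: 'a) \<longleftrightarrow> p dvd k"
    and u: "eqn_over (UT n) u" and ex: "eqn_exponent u = r * int p ^ s" "coprime r (int p)"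
    and n: "n > 0" and m: "m = (n - 1) * p ^ s + 1" and t: "t < p ^ s"
  defines "a \<equiv> eqn_value (UT n) (\<lambda>g. g) u \<one>\<^bsub>UT n\<^esub>"
  assumes nz: "(\<forall>k. 0 < k \<longrightarrow> k + p ^ s < m \<longrightarrow> a $$ ((k + t) div p ^ s, Suc ((k + t) div p ^ s)) \<noteq> 0)
    \<or> (\<forall>k. Suc k + p ^ s < m \<longrightarrow> a $$ ((k + t) div p ^ s, Suc ((k + t) div p ^ s)) \<noteq> 0)"
  shows "\<exists>f \<in> mon (UT n) (UT m). solvable_in (UT m :: 'a mat monoid) f u"
proof -
  define q where "q = p ^ s"
  define l where "l = q - 1"
  have "q > 0" using prime_gt_0_nat [OF p(1)] by (simp add: q_def)
  then have l: "Suc l = q" by (simp add: l_def)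
  have p0: "of_nat p = (0 :: 'a)" using p(2) by simp
  interpret block_embedding n m "\<lambda>k. k mod q" "\<lambda>k. (k + t) div q"
    using t n m unfolding q_def by (rule interleaved_block_embedding)
  define P where "P = p ^ (s + m)"
  have "m > 0" by (simp add: m)
  obtain r' where r': "sum_list (map fst (utm_eqn P u)) = Suc l * r'" "\<not> p dvd r'"
    using utm_eqn_exponent [OF p(1) ex \<open>m > 0\<close>] unfolding P_def l q_def by blast
  have "m < p ^ m" using prime_gt_1_nat [OF p(1)] by (intro power_gt_expt) simp
  also have "\<dots> \<le> p ^ (s + m)" using prime_gt_0_nat [OF p(1)] by (intro power_increasing) simp_all
  finally have P: "m \<le> p ^ (s + m)" by simp
  have a: "a \<in> carrier (UT n)" "utm_value (utm_eqn P u) 1 = block a"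
    using utm_value_utm_eqn_1 [OF p(1) p0 u] by (simp_all add: a_def)
  have lev: "block g - 1 \<in> lev m (Suc l)" for g :: "'a mat"
  proof -
    have "k mod q \<noteq> (k + e) mod q" if "0 < e" "e < q" for k e
      using that mod_eq_dvd_iff_nat [of k "k + e" q] by (auto dest: nat_dvd_not_less)
    then show ?thesis by (auto simp: lev_def diag_block l)
  qed
  have da: "diag (block a) q k = a $$ ((k + t) div q, Suc ((k + t) div q))" if "k + q < m" for k
  proof -
    have "(k + q + t) div q = Suc ((k + t) div q)" using div_add_self2 [of q "k + t"] \<open>q > 0\<close> by (simp add: ac_simps)
    then show ?thesis using that \<open>q > 0\<close> by (simp add: diag_block)
  qed
  have "\<exists>T. T - 1 \<in> lev m 1 \<and> utm_value (utm_eqn P u) T - 1 \<in> lev m m"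
  proof (rule utm_equation_solvable [OF p(1) p0 _ r'(1)])
    show "Suc l = p ^ s" by (simp add: l q_def)
    show "of_nat r' \<noteq> (0 :: 'a)" using p(2) r'(2) by simp
    show "\<forall>(e, G)\<in>set (utm_eqn P u). G - 1 \<in> lev m (Suc l)" by (rule utm_eqn_lev [OF lev])
    show "(\<forall>k. 0 < k \<longrightarrow> k + Suc l < m \<longrightarrow> diag (utm_value (utm_eqn P u) 1) (Suc l) k \<noteq> 0)
      \<or> (\<forall>k. Suc k + Suc l < m \<longrightarrow> diag (utm_value (utm_eqn P u) 1) (Suc l) k \<noteq> 0)"
      using nz [folded q_def]
    proof
      assume "\<forall>k. 0 < k \<longrightarrow> k + q < m \<longrightarrow> a $$ ((k + t) div q, Suc ((k + t) div q)) \<noteq> 0"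
      then show ?thesis unfolding a(2) l using da by simp
    next
      assume "\<forall>k. Suc k + q < m \<longrightarrow> a $$ ((k + t) div q, Suc ((k + t) div q)) \<noteq> 0"
      then show ?thesis unfolding a(2) l using da by simp
    qed
  qed
  then have "solvable_in (UT m) embed u"
    using solvable_in_embed [OF p(1) p0 P] unfolding P_def by blast
  then show ?thesis using embed_mon by blast
qed

subsection \<open>The central case\<close>

text \<open>Commuting with the elementary matrix at (j, n - 1), compared at (i, n - 1), kills the
  entry if j < n - 1; the one at (0, i), compared at (0, j), does so if i > 0.\<close>

lemma central_UT_zero:
  fixes a :: "'a::field mat"
  assumes a: "central (UT n) a" and ij: "i < j" "j < n" "(i, j) \<noteq> (0, n - 1)"
  shows "a $$ (i, j) = 0"
proof -
  have aC: "a \<in> carrier_mat n n" using a by (simp add: central_def UT_iff)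
  define E where "E x y = mat n n (\<lambda>(k, l). if k = l \<or> k = x \<and> l = y then 1 else 0 :: 'a)" for x y
  have EC: "E x y \<in> carrier_mat n n" for x y by (simp add: E_def)
  have comm: "a * E x y = E x y * a" if "x < y" "y < n" for x y
  proof -
    have "E x y \<in> carrier (UT n)" using that by (auto simp: UT_iff E_def)
    with a show ?thesis by (simp add: central_def)
  qed
  have right: "(a * E x y) $$ (k, l) = a $$ (k, l) + (if l = y then a $$ (k, x) else 0)"
    if "x < y" "y < n" "k < n" "l < n" for x y k l
  proof -
    have "(a * E x y) $$ (k, l) = (\<Sum>h=0..<n. a $$ (k, h) * (if h = l \<or> h = x \<and> l = y then 1 else 0))"
      using that aC by (simp add: scalar_prod_def E_def)
    also have "\<dots> = (\<Sum>h=0..<n. (if h = l then a $$ (k, h) else 0) + (if h = x then if l = y then a $$ (k, h) else 0 else 0))"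
      using that by (intro sum.cong) auto
    finally show ?thesis using that by (simp add: sum.distrib)
  qed
  have left: "(E x y * a) $$ (k, l) = a $$ (k, l) + (if k = x then a $$ (y, l) else 0)"
    if "x < y" "y < n" "k < n" "l < n" for x y k l
  proof -
    have "(E x y * a) $$ (k, l) = (\<Sum>h=0..<n. (if k = h \<or> k = x \<and> h = y then 1 else 0) * a $$ (h, l))"
      using that aC by (simp add: scalar_prod_def E_def)
    also have "\<dots> = (\<Sum>h=0..<n. (if h = k then a $$ (h, l) else 0) + (if h = y then if k = x then a $$ (h, l) else 0 else 0))"
      using that by (intro sum.cong) auto
    finally show ?thesis using that by (simp add: sum.distrib)
  qed
  consider "j < n - 1" | "i > 0" using ij by force
  then show ?thesis
  proof cases
    case 1
    then show ?thesis
      using right [of j "n - 1" i "n - 1"] left [of j "n - 1" i "n - 1"] comm [of j "n - 1"] ij by simp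
  next
    case 2
    then show ?thesis
      using right [of 0 i 0 j] left [of 0 i 0 j] comm [of 0 i] ij by simp
  qed
qed

lemma utm_value_commuting:
  "\<forall>(e, G)\<in>set us. G * T = T * G \<Longrightarrow> utm_value us T = T ^ sum_list (map fst us) * utm_value us 1"
proof (induction us)
  case (Cons u us)
  obtain e G where u: "u = (e, G)" by (cases u)
  have "G * T = T * G" using Cons.prems u by simp
  then have "G * T ^ k = T ^ k * G" for k by (metis power_commuting_commutes)
  with Cons show ?case by (simp add: u power_add mult.assoc) (simp flip: mult.assoc)
qed simp

text \<open>The adjacency matrix of the path v 0, v 1, ..., v q, with weight w on its first
  edge.\<close>

definition path_utm :: "nat \<Rightarrow> (nat \<Rightarrow> nat) \<Rightarrow> 'a \<Rightarrow> 'a::ring_1 utm" where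
  "path_utm q v w = UTM (\<lambda>d k. if \<exists>t<q. k = v t \<and> k + d = v (Suc t)
     then if k = v 0 then w else 1 else 0)"

text \<open>Powers of an adjacency matrix count weighted walks. As v is strictly increasing, at most
  one walk joins two indices, and it picks up w exactly when it starts at v 0.\<close>

lemma diag_path_utm_power:
  assumes v: "\<And>t t'. t < t' \<Longrightarrow> t' \<le> q \<Longrightarrow> v t < v t'"
  shows "diag (path_utm q v w ^ Suc j) d k =
    (if \<exists>t. t + Suc j \<le> q \<and> k = v t \<and> k + d = v (t + Suc j) then if k = v 0 then w else 1 else 0)"
proof (induction j arbitrary: d k)
  case 0
  show ?case by (simp add: path_utm_def Suc_le_eq)
next
  case (Suc j)
  let ?X = "path_utm q v w"
  have inj: "t = t'" if "v t = v t'" "t \<le> q" "t' \<le> q" for t t'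
    using v [of t t'] v [of t' t] that by (metis less_irrefl linorder_neqE_nat)
  have X: "diag ?X d k = (if \<exists>t<q. k = v t \<and> k + d = v (Suc t) then if k = v 0 then w else 1 else 0)"
    for d k by (simp add: path_utm_def)
  have exp: "diag (?X ^ Suc (Suc j)) d k =
      (\<Sum>e=0..d. diag ?X e k * diag (?X ^ Suc j) (d - e) (k + e))"
    unfolding power_Suc [of ?X "Suc j"] by (rule diag_mult)
  show ?case
  proof (cases "\<exists>t<q. k = v t \<and> v (Suc t) \<le> k + d")
    case False
    have "diag ?X e k = 0" if "e \<in> {0..d}" for e using False that by (auto simp: X)
    then have "diag (?X ^ Suc (Suc j)) d k = 0" unfolding exp by (intro sum.neutral) simp
    moreover have "\<not> (\<exists>t. t + Suc (Suc j) \<le> q \<and> k = v t \<and> k + d = v (t + Suc (Suc j)))"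
    proof clarify
      fix t assume t: "t + Suc (Suc j) \<le> q" "k = v t" "v t + d = v (t + Suc (Suc j))"
      then have "v (Suc t) \<le> v t + d" using v [of "Suc t" "t + Suc (Suc j)"] by simp
      with False t show False by auto
    qed
    ultimately show ?thesis by (simp only: if_False)
  next
    case True
    then obtain t where t: "t < q" "k = v t" "v (Suc t) \<le> k + d" by auto
    define e0 where "e0 = v (Suc t) - k"
    have k: "k + e0 = v (Suc t)" "e0 \<le> d" using t v [of t "Suc t"] by (auto simp: e0_def)
    \<comment> \<open>Row v t of the matrix has its only possible entry in column v (Suc t), so the
      sum collapses.\<close>
    have "(\<exists>t'<q. k = v t' \<and> k + e = v (Suc t')) \<longleftrightarrow> e = e0" for e
    proof
      assume "\<exists>t'<q. k = v t' \<and> k + e = v (Suc t')"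
      then obtain t' where t': "t' < q" "k = v t'" "k + e = v (Suc t')" by blast
      have "v t' = v t" "t' \<le> q" "t \<le> q" using t t' by simp_all
      then have "t' = t" by (rule inj)
      then show "e = e0" using k(1) t'(3) by (metis add_left_cancel)
    next
      assume "e = e0"
      then show "\<exists>t'<q. k = v t' \<and> k + e = v (Suc t')" using t k(1) by blast
    qed
    then have Xe: "diag ?X e k = (if e = e0 then if k = v 0 then w else 1 else 0)" for e
      unfolding X by (simp only:)
    have "diag (?X ^ Suc (Suc j)) d k = (if k = v 0 then w else 1) * diag (?X ^ Suc j) (d - e0) (v (Suc t))"
    proof -
      have "(\<Sum>e=0..d. diag ?X e k * diag (?X ^ Suc j) (d - e) (k + e)) =
          (\<Sum>e=0..d. if e = e0 then (if k = v 0 then w else 1) * diag (?X ^ Suc j) (d - e0) (v (Suc t)) else 0)"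
        unfolding Xe using k by (intro sum.cong) auto
      then show ?thesis unfolding exp using k by simp
    qed
    also have "diag (?X ^ Suc j) (d - e0) (v (Suc t)) =
        (if \<exists>t'. t' + Suc j \<le> q \<and> v (Suc t) = v t' \<and> k + d = v (t' + Suc j) then 1 else 0)"
    proof -
      have "v (Suc t) \<noteq> v 0" using v [of 0 "Suc t"] t by simp
      moreover have "v (Suc t) + (d - e0) = k + d" using k by linarith
      ultimately show ?thesis unfolding Suc.IH by (simp only: if_False)
    qed
    also have "(\<exists>t'. t' + Suc j \<le> q \<and> v (Suc t) = v t' \<and> k + d = v (t' + Suc j)) \<longleftrightarrow>
        (\<exists>t'. t' + Suc (Suc j) \<le> q \<and> k = v t' \<and> k + d = v (t' + Suc (Suc j)))"
    proof
      assume "\<exists>t'. t' + Suc j \<le> q \<and> v (Suc t) = v t' \<and> k + d = v (t' + Suc j)"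
      then obtain t' where t': "t' + Suc j \<le> q" "v (Suc t) = v t'" "k + d = v (t' + Suc j)" by blast
      then have "t' = Suc t" using t inj [of "Suc t" t'] by simp
      then have "t + Suc (Suc j) \<le> q" "k + d = v (t + Suc (Suc j))" using t' by simp_all
      with t(2) show "\<exists>t'. t' + Suc (Suc j) \<le> q \<and> k = v t' \<and> k + d = v (t' + Suc (Suc j))"
        by blast
    next
      assume "\<exists>t'. t' + Suc (Suc j) \<le> q \<and> k = v t' \<and> k + d = v (t' + Suc (Suc j))"
      then obtain t' where t': "t' + Suc (Suc j) \<le> q" "k = v t'" "k + d = v (t' + Suc (Suc j))" by blast
      then have "t' = t" using t inj [of t t'] by simp
      then have "Suc t + Suc j \<le> q" "k + d = v (Suc t + Suc j)" using t' by simp_all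
      then show "\<exists>t'. t' + Suc j \<le> q \<and> v (Suc t) = v t' \<and> k + d = v (t' + Suc j)"
        by blast
    qed
    finally show ?thesis
      by (cases "\<exists>t. t + Suc (Suc j) \<le> q \<and> k = v t \<and> k + d = v (t + Suc (Suc j))")
        (simp_all only: if_True if_False mult_1_right mult_zero_right)
  qed
qed

text \<open>Block 0 consists of the first n - 1 indices and m - 1. Each index in between is alone in
  its block, with the dummy role 0.\<close>

lemma corner_block_embedding:
  assumes n: "n \<ge> 2" and m: "n \<le> m"
    and b: "\<And>k. b k = (if n - 1 \<le> k \<and> k < m - 1 then k else 0)"
    and c: "\<And>k. c k = (if k < n - 1 then k else if k = m - 1 then n - 1 else 0)"
  shows "block_embedding n m b c"
proof
  fix k assume "k < m"
  then show "c k < n" using n by (auto simp: c)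
next
  fix k l assume kl: "k < l" "l < m" "b k = b l"
  then have *: "k < n - 1" "l < n - 1 \<or> l = m - 1" using n by (auto simp: b split: if_splits)
  then show "c k < c l" using kl by (auto simp: c)
  fix i assume "c k < i" "i < c l"
  then have "i < n - 1" using * kl by (auto simp: c split: if_splits)
  then have "b i = b k" "c i = i" "i < m" using * n m by (simp_all add: b c)
  then show "\<exists>j<m. b j = b k \<and> c j = i" by blast
next
  have "\<exists>k<m. b k = 0 \<and> c k = i" if "i < n" for i
  proof (cases "i < n - 1")
    case True
    then show ?thesis using m by (intro exI [of _ i]) (simp add: b c)
  next
    case False
    then show ?thesis using that n m by (intro exI [of _ "m - 1"]) (auto simp: b c)
  qed
  then show "\<exists>\<beta>. \<forall>i<n. \<exists>k<m. b k = \<beta> \<and> c k = i" by blast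
qed

text \<open>As T = 1 + X commutes with the coefficients, u(T) is (1 + X^q)^r' times the image of
  \<open>a\<close>. Both X^q and, by centrality, that image minus 1 live only in the upper right
  corner, where w makes them cancel.\<close>

lemma solvable_central:
  fixes u :: "'a::field mat eqn"
  assumes p: "prime p" "\<And>k. of_nat k = (0 :: 'a) \<longleftrightarrow> p dvd k"
    and u: "eqn_over (UT n) u" and ex: "eqn_exponent u = r * int p ^ s" "coprime r (int p)"
    and n: "n \<ge> 2" and m: "m = (n - 1) * p ^ s + 1"
  defines "a \<equiv> eqn_value (UT n) (\<lambda>g. g) u \<one>\<^bsub>UT n\<^esub>"
  assumes central: "central (UT n) a"
  shows "\<exists>f \<in> mon (UT n) (UT m). solvable_in (UT m :: 'a mat monoid) f u"
proof -
  define q where "q = p ^ s"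
  have "q > 0" using prime_gt_0_nat [OF p(1)] by (simp add: q_def)
  have p0: "of_nat p = (0 :: 'a)" using p(2) by simp
  have mq: "m - 1 = (n - 1) * q" by (simp add: m q_def)
  \<comment> \<open>This makes room for the q - 1 inner indices n - 1, ..., n + q - 3 of the path
    below m - 1.\<close>
  have "(n - 2) * 1 \<le> (n - 2) * q" using \<open>q > 0\<close> by (intro mult_left_mono) simp_all
  moreover have "(n - 1) * q = (n - 2) * q + q" using n by (metis Suc_1 Suc_diff_le add.commute diff_Suc_Suc mult_Suc)
  ultimately have nqm: "n - 2 + q \<le> m - 1" unfolding mq by simp
  have m2: "m \<ge> 2" "n \<le> m" using nqm \<open>q > 0\<close> n by simp_all
  define b where "b k = (if n - 1 \<le> k \<and> k < m - 1 then k else 0)" for k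
  define c where "c k = (if k < n - 1 then k else if k = m - 1 then n - 1 else 0)" for k
  interpret block_embedding n m b c
    by (rule corner_block_embedding [OF n m2(2) b_def c_def])
  define P where "P = p ^ (s + m)"
  have "m > 0" by (simp add: m)
  obtain r' where r': "sum_list (map fst (utm_eqn P u)) = q * r'" "\<not> p dvd r'"
    using utm_eqn_exponent [OF p(1) ex \<open>m > 0\<close>] unfolding P_def q_def by blast
  have r'0: "of_nat r' \<noteq> (0 :: 'a)" using p(2) r'(2) by simp
  have "m < p ^ m" using prime_gt_1_nat [OF p(1)] by (intro power_gt_expt) simp
  also have "\<dots> \<le> p ^ (s + m)" using prime_gt_0_nat [OF p(1)] by (intro power_increasing) simp_all
  finally have P: "m \<le> p ^ (s + m)" by simp
  have a: "a \<in> carrier (UT n)" "utm_value (utm_eqn P u) 1 = block a"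
    using utm_value_utm_eqn_1 [OF p(1) p0 u] by (simp_all add: a_def)

  define v where "v t = (if t = 0 then 0 else if t < q then n - 2 + t else m - 1)" for t
  have v_mono: "v t < v t'" if "t < t'" "t' \<le> q" for t t'
    using that nqm n m2 by (auto simp: v_def)
  have v0: "v 0 = 0" by (simp add: v_def)
  define w where "w = - a $$ (0, n - 1) / of_nat r'"
  define X where "X = path_utm q v w"
  have X: "diag X d k = (if \<exists>t<q. k = v t \<and> k + d = v (Suc t) then if k = 0 then w else 1 else 0)" for d k
    by (simp only: X_def path_utm_def v0 utm.sel)
  have b_v: "b (v t) = v t" "v t > 0" if "0 < t" "t < q" for t
    using that nqm n by (auto simp: b_def v_def)
  have b_eq: "k = v t" if "b k = b (v t)" "0 < t" "t < q" for k t
    using that(1) b_v [OF that(2,3)] by (auto simp: b_def split: if_splits)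
  \<comment> \<open>A term with e > 0 meets a row v t of \<open>X\<close> with v t > k, hence an
    inner index of the path, which shares its block with no other index.\<close>
  have BX: "block g * X = X" for g :: "'a mat"
  proof (rule utm_eqI)
    fix d k
    have "diag (block g) e k * diag X (d - e) (k + e) = (if e = 0 then diag X d k else 0)"
      if e: "e \<in> {0..d}" for e
    proof (cases "e > 0 \<and> diag X (d - e) (k + e) \<noteq> 0")
      case True
      then obtain t where t: "t < q" "k + e = v t" by (auto simp: X split: if_splits)
      have "t > 0" using t True by (cases t) (auto simp: v_def)
      with b_eq [of k t] t True have "b k \<noteq> b (k + e)" by auto
      with True show ?thesis by (simp add: diag_block)
    qed (auto simp: diag_block)
    then show "diag (block g * X) d k = diag X d k" by (simp add: diag_mult)
  qed
  \<comment> \<open>Dually, a column of \<open>X\<close> is an inner index, alone in its block, or m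
    - 1, to the right of which nothing follows.\<close>
  have XB: "X * block g = X" for g :: "'a mat"
  proof (rule utm_eqI)
    fix d k
    have "diag X e k * diag (block g) (d - e) (k + e) = (if e = d then diag X d k else 0)"
      if e: "e \<in> {0..d}" for e
    proof (cases "e < d \<and> diag X e k \<noteq> 0")
      case True
      then obtain t where t: "t < q" "k + e = v (Suc t)" by (auto simp: X split: if_splits)
      have "\<not> (k + d < m \<and> b (k + e) = b (k + d))"
      proof (cases "Suc t < q")
        case True
        then show ?thesis using b_eq [of "k + d" "Suc t"] t \<open>e < d \<and> _\<close> by auto
      next
        case False
        then show ?thesis using t True by (auto simp: v_def)
      qed
      with True show ?thesis by (auto simp: diag_block)
    qed (use e in \<open>auto simp: diag_block\<close>)
    then show "diag (X * block g) d k = diag X d k" by (simp add: diag_mult)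
  qed
  define Z where "Z = X ^ q"
  \<comment> \<open>The only walk of length q is the whole path from 0 to m - 1.\<close>
  have Zd: "diag Z d k = (if d = m - 1 \<and> k = 0 then w else 0)" for d k
  proof -
    obtain j where j: "q = Suc j" using \<open>q > 0\<close> gr0_implies_Suc by blast
    have vq: "v q = m - 1" "v 0 = 0" using j by (simp_all add: v_def)
    have "diag Z d k = (if \<exists>t. t + q \<le> q \<and> k = v t \<and> k + d = v (t + q) then if k = v 0 then w else 1 else 0)"
      unfolding Z_def X_def using diag_path_utm_power [of q v w j d k, OF v_mono] by (simp only: j)
    then show ?thesis using vq by auto
  qed
  have Z: "Z \<in> lev m (m - 1)" by (simp add: lev_def Zd)
  define T where "T = 1 + X"
  have T1: "T - 1 \<in> lev m 1"
  proof -
    have "v t \<noteq> v (Suc t)" if "t < q" for t using v_mono [of t "Suc t"] that by simp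
    then have "\<not> (\<exists>t<q. k = v t \<and> k + 0 = v (Suc t))" for k by auto
    then have "diag X 0 k = 0" for k by (simp only: X if_False)
    then show ?thesis by (simp add: T_def lev_def)
  qed
  have "T ^ q = 1 + Z"
    unfolding T_def Z_def q_def by (rule one_plus_power_prime_power [OF p(1) of_nat_utm_eq_0 [OF p0]])
  then have Tp: "T ^ (q * r') = (1 + Z) ^ r'" by (simp add: power_mult)
  define R where "R = (1 + Z) ^ r' - 1 - of_nat r' * Z"
  have R: "R \<in> lev m m"
    using lev_power_diff [of "1 + Z" 1 m "m - 1" r'] Z lev_mono [OF Z, of 1] m2 by (simp add: R_def)
  have B: "block a - 1 \<in> lev m (m - 1)"
  proof -
    have "a $$ (c k, c (k + d)) = 0" if "d < m - 1" "0 < d" "k + d < m" "b k = b (k + d)" for d k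
    proof (rule central_UT_zero [OF central])
      show "c k < c (k + d)" "c (k + d) < n" using that by (simp_all add: c_mono c_less)
      show "(c k, c (k + d)) \<noteq> (0, n - 1)"
        using that n by (auto simp: b_def c_def split: if_splits)
    qed
    then show ?thesis by (auto simp: lev_def diag_block)
  qed
  have BT: "block g * T = T * block g" for g :: "'a mat"
    by (simp add: T_def distrib_left distrib_right BX XB)
  have "utm_value (utm_eqn P u) T = T ^ (q * r') * block a"
    unfolding r'(1) [symmetric] a(2) [symmetric]
    by (rule utm_value_commuting) (auto simp: utm_eqn_def BT)
  then have val: "utm_value (utm_eqn P u) T - 1 =
      R * block a + (block a - 1 + of_nat r' * Z) + of_nat r' * (Z * (block a - 1))"
    unfolding Tp R_def by (simp add: algebra_simps)
  have "Z * (block a - 1) \<in> lev m m" using m2 by (intro lev_mono [OF lev_mult [OF Z B]]) simp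
  moreover have "block a - 1 + of_nat r' * Z \<in> lev m (Suc (m - 1))"
  proof (rule lev_SucI)
    show "block a - 1 + of_nat r' * Z \<in> lev m (m - 1)" using B Z by (simp add: lev_add lev_of_nat_mult)
    fix k assume "k + (m - 1) < m"
    then have "k = 0" using m2 by simp
    moreover have "b 0 = b (m - 1)" "c 0 = 0" "c (m - 1) = n - 1" using n m2 by (auto simp: b_def c_def)
    ultimately show "diag (block a - 1 + of_nat r' * Z) (m - 1) k = 0"
      using m2 r'0 by (simp add: diag_block diag_of_nat_mult Zd w_def)
  qed
  then have "block a - 1 + of_nat r' * Z \<in> lev m m" using m2 by simp
  ultimately have "utm_value (utm_eqn P u) T - 1 \<in> lev m m"
    unfolding val by (intro lev_add [OF lev_add [OF lev_mult_right [OF R]]] lev_of_nat_mult)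
  then have "solvable_in (UT m) embed u"
    using solvable_in_embed [OF p(1) p0 P T1] unfolding P_def by blast
  then show ?thesis using embed_mon by blast
qed

section \<open>The characteristic of the field and the three cases\<close>

text \<open>The characteristic divides the prime p and is not 1.\<close>

lemma of_nat_eq_0_iff_CARD:
  assumes "prime p" "CARD('a::field) = p"
  shows "of_nat k = (0 :: 'a) \<longleftrightarrow> p dvd k"
proof -
  have "CHAR('a) dvd p" using CHAR_dvd_CARD [where 'a = 'a] assms(2) by simp
  moreover have "CHAR('a) \<noteq> 1" using of_nat_CHAR [where 'a = 'a] by (metis of_nat_1 one_neq_zero)
  ultimately have "CHAR('a) = p" using assms(1) by (auto simp: prime_nat_iff)
  then show ?thesis by (simp add: of_nat_eq_0_iff_char_dvd)
qed

theorem theorem3p6: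
  fixes u :: "'a::field mat eqn" and a :: "'a mat"
    and p n s m :: nat and r :: int
  assumes "prime p"
    and "CARD('a) = p"
    and "n \<ge> 2"
    and "eqn_over (UT n) u"
    and "regular_eqn u"
    and "eqn_exponent u = r * int p ^ s"
    and "coprime r (int p)"
    and "a = eqn_value (UT n) (\<lambda>g. g) u \<one>\<^bsub>UT n\<^esub>"
    and "(\<forall>i\<in>{2..n - 1}. entry a i (i + 1) \<noteq> 0)
       \<or> (\<forall>i\<in>{1..n - 2}. entry a i (i + 1) \<noteq> 0)
       \<or> central (UT n) a"
    and "m = (n - 1) * p ^ s + 1"
  shows "\<exists>(H :: 'a mat monoid) f.
           overgroup (UT n :: 'a mat monoid) H f \<and> H \<cong> (UT m :: 'a mat monoid) \<and> solvable_in H f u"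
proof -
  have char: "of_nat k = (0 :: 'a) \<longleftrightarrow> p dvd k" for k
    using assms(1,2) by (rule of_nat_eq_0_iff_CARD)
  have q: "p ^ s > 0" using prime_gt_0_nat [OF assms(1)] by simp
  note interleaved = solvable_interleaved [OF assms(1) char assms(4,6,7) _ assms(10), folded assms(8)]
  have "\<exists>f \<in> mon (UT n) (UT m). solvable_in (UT m :: 'a mat monoid) f u"
    using assms(9)
  proof (elim disjE)
    assume nz: "\<forall>i\<in>{2..n - 1}. entry a i (i + 1) \<noteq> 0"
    show ?thesis
    \<comment> \<open>This shift rounds k / q up, so the unrestricted entry in row 1 occurs on
      superdiagonal q only at k = 0.\<close>
    proof (rule interleaved [of "p ^ s - 1"])
      show "(\<forall>k. 0 < k \<longrightarrow> k + p ^ s < m \<longrightarrow>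
            a $$ ((k + (p ^ s - 1)) div p ^ s, Suc ((k + (p ^ s - 1)) div p ^ s)) \<noteq> 0) \<or>
          (\<forall>k. Suc k + p ^ s < m \<longrightarrow>
            a $$ ((k + (p ^ s - 1)) div p ^ s, Suc ((k + (p ^ s - 1)) div p ^ s)) \<noteq> 0)"
      proof (rule disjI1, intro allI impI)
        fix k assume k: "0 < k" "k + p ^ s < m"
        define i where "i = (k + (p ^ s - 1)) div p ^ s"
        have "1 * p ^ s \<le> k + (p ^ s - 1)" using k by simp
        then have "1 \<le> i" unfolding i_def using q by (simp only: less_eq_div_iff_mult_less_eq)
        moreover have "k + (p ^ s - 1) < (n - 1) * p ^ s" using k q unfolding assms(10) by linarith
        then have "i < n - 1" unfolding i_def by (rule less_mult_imp_div_less)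
        ultimately have "entry a (Suc i) (Suc i + 1) \<noteq> 0" using nz by (intro bspec [OF nz]) simp
        then show "a $$ (i, Suc i) \<noteq> 0" by (simp add: entry_def)
      qed
    qed (use q assms(3) in simp_all)
  next
    assume nz: "\<forall>i\<in>{1..n - 2}. entry a i (i + 1) \<noteq> 0"
    show ?thesis
    \<comment> \<open>Without a shift k / q is rounded down, so the unrestricted entry in row n - 1
      occurs only at the last place k = (n - 2) q.\<close>
    proof (rule interleaved [of 0])
      show "(\<forall>k. 0 < k \<longrightarrow> k + p ^ s < m \<longrightarrow>
            a $$ ((k + 0) div p ^ s, Suc ((k + 0) div p ^ s)) \<noteq> 0) \<or>
          (\<forall>k. Suc k + p ^ s < m \<longrightarrow> a $$ ((k + 0) div p ^ s, Suc ((k + 0) div p ^ s)) \<noteq> 0)"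
      proof (rule disjI2, intro allI impI)
        fix k assume k: "Suc k + p ^ s < m"
        define i where "i = (k + 0) div p ^ s"
        have "k + p ^ s < (n - 1) * p ^ s" using k assms(10) by simp
        then have "Suc i < n - 1" unfolding i_def using q
          by (metis add_0_right div_add_self2 less_mult_imp_div_less not_gr_zero Suc_eq_plus1 not_less_zero)
        then have "entry a (Suc i) (Suc i + 1) \<noteq> 0" by (intro bspec [OF nz]) simp
        then show "a $$ (i, Suc i) \<noteq> 0" by (simp add: entry_def)
      qed
    qed (use q assms(3) in simp_all)
  next
    assume "central (UT n) a"
    then show ?thesis
      using solvable_central [OF assms(1) char assms(4,6,7,3,10)] by (simp only: assms(8))
  qed
  moreover have "group (UT m :: 'a mat monoid)" using assms(1) char by (intro group_UT [of p]) simp_all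
  ultimately show ?thesis unfolding overgroup_def by (blast intro: iso_refl)
qed

end
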